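(* Original power grid: let $Y^{(1)}=\begin{pmatrix} Y_{L_1L_1} & Y_{L_1S_1} \\ Y_{S_1L_1} & Y_{S_1S_1} \end{pmatrix}$ be the weighted Laplacian of a graph on load nodes $L_1$ and source nodes $S_1$, whose nodes are partitioned into microgrids $\mathcal M_1,\dots,\mathcal M_k$, each containing at least one load node, satisfying the descending path condition. Let $E_{L_1}\ge 0$ be a diagonal matrix (virtual shunts), $V_{S_1}>0$ the source voltages and $P_{L_1}>0$ the load powers. Let $CDC^\top=Y_{L_1L_1}+E_{L_1}$ be the block Cholesky decomposition with blocks given by the load nodes of $\mathcal M_1,\dots,\mathcal M_k$, put $V_{L_1}':=-(Y_{L_1L_1}+E_{L_1})^{-1}Y_{L_1S_1}V_{S_1}$, and suppose that $$D^{-1}C^{-1}[C^\top V_{L_1}']^{-1}P_{L_1}<\tfrac14\,C^\top V_{L_1}'.$$ New microgrid: let $\begin{pmatrix} Y_{L_2L_2} & Y_{L_2S_2} \\ Y_{S_2L_2} & Y_{S_2S_2} \end{pmatrix}$ be the weighted Laplacian of a graph on load nodes $L_2\neq\emptyset$ and source nodes $S_2$, let $E_{L_2}\ge0$ be a diagonal matrix (virtual shunts), $V_{S_2}>0$ the source voltages and $P_{L_2}>0$ the load powers. Interconnection: let the interconnection, obtained by adding weighted edges between nodes of $L_1\cup S_1$ and nodes of $L_2\cup S_2$, have weighted Laplacian $$\begin{pmatrix} Y_{L_1L_1}+\hat E_{L_1} & Y_{L_1L_2} & Y_{L_1S_1} & Y_{L_1S_2} \\ Y_{L_2L_1} & Y_{L_2L_2}+\hat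 E_{L_2} & Y_{L_2S_1} & Y_{L_2S_2} \\ Y_{S_1L_1} & Y_{S_1L_2} & Y_{S_1S_1}+\hat E_{S_1} & Y_{S_1S_2} \\ Y_{S_2L_1} & Y_{S_2L_2} & Y_{S_2S_1} & Y_{S_2S_2}+\hat E_{S_2} \end{pmatrix},$$ where, with $\mathbf 1$ the all-ones vector, $\hat E_{L_1}=-[Y_{L_1L_2}\mathbf 1+Y_{L_1S_2}\mathbf 1]$, $\hat E_{L_2}=-[Y_{L_2L_1}\mathbf 1+Y_{L_2S_1}\mathbf 1]$, $\hat E_{S_1}=-[Y_{S_1L_2}\mathbf 1+Y_{S_1S_2}\mathbf 1]$, $\hat E_{S_2}=-[Y_{S_2L_1}\mathbf 1+Y_{S_2S_1}\mathbf 1]$. Suppose that $\hat E_{L_1}\le E_{L_1}$, $\hat E_{L_2}\le E_{L_2}$, and that the interconnected graph, with microgrids $\mathcal M_1,\dots,\mathcal M_k,\mathcal M_{k+1}$ where $\mathcal M_{k+1}$ is the new microgrid with nodes $L_2\cup S_2$, satisfies the descending path condition. Let $\tilde C\tilde D\tilde C^\top=\begin{pmatrix} Y_{L_1L_1}+E_{L_1} & Y_{L_1L_2} \\ Y_{L_2L_1} & Y_{L_2L_2}+E_{L_2} \end{pmatrix}$ be the block Cholesky decomposition with blocks given by the load nodes of $\mathcal M_1,\dots,\mathcal M_{k+1}$, and set $$R:=Y_{L_2L_2}+E_{L_2}-Y_{L_2L_1}(CDC^\top)^{-1}Y_{L_1L_2},$$ $$V_L':=-(\tilde C\tilde D\tilde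 C^\top)^{-1}\begin{pmatrix} Y_{L_1S_1} & Y_{L_1S_2} \\ Y_{L_2S_1} & Y_{L_2S_2} \end{pmatrix}\begin{pmatrix} V_{S_1} \\ V_{S_2} \end{pmatrix}.$$ Let $(\tilde C^\top V_L')_{L_1}$ and $(\tilde C^\top V_L')_{L_2}$ be the subvectors of $\tilde C^\top V_L'$ indexed by $L_1$ and $L_2$. If $$-R^{-1}Y_{L_2L_1}(CDC^\top)^{-1}[(\tilde C^\top V_L')_{L_1}]^{-1}P_{L_1}+R^{-1}[(\tilde C^\top V_L')_{L_2}]^{-1}P_{L_2}<\tfrac14(\tilde C^\top V_L')_{L_2},$$ then $$\tilde D^{-1}\tilde C^{-1}[\tilde C^\top V_L']^{-1}\begin{pmatrix} P_{L_1} \\ P_{L_2} \end{pmatrix}<\tfrac14\,\tilde C^\top V_L'$$ and the interconnection of the power grid and the microgrid is feasible, i.e. the triple $$\left(\begin{pmatrix} Y_{L_1L_1}+\hat E_{L_1} & Y_{L_1L_2} \\ Y_{L_2L_1} & Y_{L_2L_2}+\hat E_{L_2} \end{pmatrix},\ -\begin{pmatrix} Y_{L_1S_1} & Y_{L_1S_2} \\ Y_{L_2S_1} & Y_{L_2S_2} \end{pmatrix}\begin{pmatrix} V_{S_1} \\ V_{S_2} \end{pmatrix},\ \begin{pmatrix} P_{L_1} \\ P_{L_2} \end{pmatrix}\right)$$ is feasible.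
   Context: All vectors and matrices are real. Inequalities between vectors or matrices are elementwise. For a vector $d$, $[d]:=\mathrm{diag}(d_1,\dots,d_n)$. Graphs are finite, undirected, without self-loops, with edge weights $w(e)>0$; they need not be connected. The weighted Laplacian $Y$ of $(\mathcal V,\mathcal E,w)$ is $Y_{ij}=-w(\{i,j\})$ if $\{i,j\}\in\mathcal E$, $Y_{ij}=0$ if $i\ne j$ and $\{i,j\}\notin\mathcal E$, and $Y_{ii}=-\sum_{j\neq i}Y_{ij}$. Nodes are partitioned into load nodes and source nodes. Descending path condition: for a graph whose nodes are partitioned into microgrids $\mathcal M_1,\mathcal M_2,\dots$ (numbered in this order), the condition says that for every load node $v$ there is a path $(v_1,\dots,v_l)$ in the graph (consecutive nodes joined by edges) with $v_1=v$ and $v_l$ a source node, such that whenever $v_p\in\mathcal M_s$, $v_q\in\mathcal M_t$ and $p<q$, then $s\ge t$. Feasible: for a square matrix $A$ and vectors $b\ge0$, $c>0$, the triple $(A,b,c)$ is feasible if there is a vector $x>0$ with $[x]Ax-[b]x+c=0$. Block Cholesky decomposition (BCD): let $A$ be a symmetric positive definite matrix whose rows and columns are partitioned into $m$ nonempty blocks of sizes $n_1,\dots,n_m$, with blocks $a_{ij}\in\mathbb R^{n_i\times n_j}$. Let $A_i$ be the leading principal submatrix formed by blocks $1,\dots,i$, and $\alpha_i:=(a_{i1}\ \cdots\ a_{i,i-1})$. Define $C_1:=I_{n_1}$, $D_1:=a_{11}$, and for $i=2,\dots,m$ $$C_i:=\begin{pmatrix} C_{i-1} & 0 \\ \alpha_iA_{i-1}^{-1}C_{i-1}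 & I_{n_i} \end{pmatrix},\qquad D_i:=\begin{pmatrix} D_{i-1} & 0 \\ 0 & a_{ii}-\alpha_iA_{i-1}^{-1}\alpha_i^\top \end{pmatrix}.$$ Then $A_i=C_iD_iC_i^\top$, and the BCD of $A$ is $A=CDC^\top$ with $C:=C_m$, $D:=D_m$. In particular $$\tilde C^{-1}=\begin{pmatrix} C^{-1} & 0 \\ -Y_{L_2L_1}(CDC^\top)^{-1} & I \end{pmatrix},\qquad \tilde D^{-1}=\begin{pmatrix} D^{-1} & 0 \\ 0 & R^{-1} \end{pmatrix}.$$ Under the stated hypotheses the matrices decomposed above are symmetric positive definite. *)

theory Defs
  imports Complex_Main "Jordan_Normal_Form.Gauss_Jordan_Elimination"
begin

text \<open>The library's \<open><\<close> on vectors is the strict part of the elementwise order \<open>\<le>\<close>,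
  that is, \<open>v \<le> w\<close> and not \<open>w \<le> v\<close>. Strict inequality in every entry is a different relation.\<close>

definition vec_less :: "real vec \<Rightarrow> real vec \<Rightarrow> bool"  (infix \<open>\<lless>\<close> 50) where
  "v \<lless> w \<longleftrightarrow> dim_vec v = dim_vec w \<and> (\<forall>i < dim_vec w. v $ i < w $ i)"

definition diag :: "real vec \<Rightarrow> real mat" where
  "diag d = mat_diag (dim_vec d) (\<lambda>i. d $ i)"

definition ones :: "nat \<Rightarrow> real vec" where
  "ones n = vec n (\<lambda>_. 1)"

text \<open>Unspecified if \<open>A\<close> is not invertible.\<close>

definition minv :: "real mat \<Rightarrow> real mat" where
  "minv A = the (mat_inverse A)"

definition subblock :: "real mat \<Rightarrow> nat \<Rightarrow> nat \<Rightarrow> nat \<Rightarrow> nat \<Rightarrow> real mat" where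
  "subblock A r nr c nc = mat nr nc (\<lambda>(i, j). A $$ (r + i, c + j))"

definition feasible :: "real mat \<Rightarrow> real vec \<Rightarrow> real vec \<Rightarrow> bool" where
  "feasible A b c \<longleftrightarrow>
     (let n = dim_row A in
      A \<in> carrier_mat n n \<and> b \<in> carrier_vec n \<and> c \<in> carrier_vec n \<and> 0\<^sub>v n \<le> b \<and> 0\<^sub>v n \<lless> c \<and>
      (\<exists>x \<in> carrier_vec n. 0\<^sub>v n \<lless> x \<and> diag x * A *\<^sub>v x - diag b *\<^sub>v x + c = 0\<^sub>v n))"

text \<open>The list \<open>ns\<close> contains the block sizes. Block \<open>i\<close>, counted from 1, has size \<open>ns ! (i - 1)\<close>
  and starts at the row and column \<open>block_start ns (i - 1)\<close>, counted from 0; thus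
  \<open>leading ns A i\<close> is formed by the blocks \<open>1, \<dots>, i\<close>, and \<open>block_row ns A i\<close> is \<open>\<alpha>\<^sub>i\<close>.\<close>

definition block_start :: "nat list \<Rightarrow> nat \<Rightarrow> nat" where
  "block_start ns i = sum_list (take i ns)"

definition leading :: "nat list \<Rightarrow> real mat \<Rightarrow> nat \<Rightarrow> real mat" where
  "leading ns A i = subblock A 0 (block_start ns i) 0 (block_start ns i)"

definition block_row :: "nat list \<Rightarrow> real mat \<Rightarrow> nat \<Rightarrow> real mat" where
  "block_row ns A i = subblock A (block_start ns (i - 1)) (ns ! (i - 1)) 0 (block_start ns (i - 1))"

definition diag_block :: "nat list \<Rightarrow> real mat \<Rightarrow> nat \<Rightarrow> real mat" where
  "diag_block ns A i =
     subblock A (block_start ns (i - 1)) (ns ! (i - 1)) (block_start ns (i - 1)) (ns ! (i - 1))"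

text \<open>The recursions start at \<open>i = 1\<close>; the value at 0 is a placeholder.\<close>

fun bcd_C_upto :: "nat list \<Rightarrow> real mat \<Rightarrow> nat \<Rightarrow> real mat" where
  "bcd_C_upto ns A 0 = 1\<^sub>m 0"
| "bcd_C_upto ns A (Suc 0) = 1\<^sub>m (ns ! 0)"
| "bcd_C_upto ns A (Suc (Suc i)) =
     (let C = bcd_C_upto ns A (Suc i);
          \<alpha> = block_row ns A (Suc (Suc i));
          n = ns ! Suc i
      in four_block_mat
           C                                       (0\<^sub>m (block_start ns (Suc i)) n)
           (\<alpha> * minv (leading ns A (Suc i)) * C)   (1\<^sub>m n))"

fun bcd_D_upto :: "nat list \<Rightarrow> real mat \<Rightarrow> nat \<Rightarrow> real mat" where
  "bcd_D_upto ns A 0 = 1\<^sub>m 0"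
| "bcd_D_upto ns A (Suc 0) = diag_block ns A (Suc 0)"
| "bcd_D_upto ns A (Suc (Suc i)) =
     (let \<alpha> = block_row ns A (Suc (Suc i));
          N = block_start ns (Suc i);
          n = ns ! Suc i
      in four_block_mat
           (bcd_D_upto ns A (Suc i))   (0\<^sub>m N n)
           (0\<^sub>m n N)   (diag_block ns A (Suc (Suc i)) - \<alpha> * minv (leading ns A (Suc i)) * \<alpha>\<^sup>T))"

definition bcd_C :: "nat list \<Rightarrow> real mat \<Rightarrow> real mat" where
  "bcd_C ns A = bcd_C_upto ns A (length ns)"

definition bcd_D :: "nat list \<Rightarrow> real mat \<Rightarrow> real mat" where
  "bcd_D ns A = bcd_D_upto ns A (length ns)"

definition weighted_graph :: "'v set \<Rightarrow> 'v set set \<Rightarrow> ('v set \<Rightarrow> real) \<Rightarrow> bool" where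
  "weighted_graph V E w \<longleftrightarrow>
     finite V \<and> (\<forall>e\<in>E. e \<subseteq> V \<and> card e = 2) \<and> (\<forall>e\<in>E. 0 < w e)"

definition laplacian :: "'v set \<Rightarrow> 'v set set \<Rightarrow> ('v set \<Rightarrow> real) \<Rightarrow> 'v \<Rightarrow> 'v \<Rightarrow> real" where
  "laplacian V E w u v =
     (let y = (\<lambda>x. if {u, x} \<in> E then - w {u, x} else 0)
      in if u = v then - (\<Sum>x \<in> V - {u}. y x) else y v)"

text \<open>The submatrix with rows \<open>us\<close> and columns \<open>vs\<close>, both given as enumerations of nodes.\<close>

definition node_mat :: "('v \<Rightarrow> 'v \<Rightarrow> real) \<Rightarrow> 'v list \<Rightarrow> 'v list \<Rightarrow> real mat" where
  "node_mat Y us vs = mat (length us) (length vs) (\<lambda>(i, j). Y (us ! i) (vs ! j))"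

text \<open>A microgrid is given by an enumeration of its load nodes and one of its source nodes. Listing
  the loads of a grid microgrid by microgrid makes the blocks of load nodes contiguous.\<close>

type_synonym 'v microgrid = "'v list \<times> 'v list"

definition loads :: "'v microgrid list \<Rightarrow> 'v list" where
  "loads Ms = concat (map fst Ms)"

definition sources :: "'v microgrid list \<Rightarrow> 'v list" where
  "sources Ms = concat (map snd Ms)"

definition nodes :: "'v microgrid \<Rightarrow> 'v set" where
  "nodes M = set (fst M) \<union> set (snd M)"

definition load_block_sizes :: "'v microgrid list \<Rightarrow> nat list" where
  "load_block_sizes Ms = map (\<lambda>M. length (fst M)) Ms"

definition descending_path_condition :: "'v microgrid list \<Rightarrow> 'v set set \<Rightarrow> bool" where
  "descending_path_condition Ms E \<longleftrightarrow>
     (\<forall>v \<in> set (loads Ms). \<exists>p. p \<noteq> [] \<and> hd p = v \<and> last p \<in> set (sources Ms) \<and>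
        successively (\<lambda>x y. {x, y} \<in> E) p \<and>
        (\<forall>i j s t. i < j \<and> j < length p \<and> s < length Ms \<and> t < length Ms \<and>
           p ! i \<in> nodes (Ms ! s) \<and> p ! j \<in> nodes (Ms ! t) \<longrightarrow> t \<le> s))"

text \<open>Adding the edges \<open>F\<close> between the nodes of two graphs adds \<open>-[Y\<^sub>1\<^sub>2 1]\<close> to the diagonal
  block of the first graph, where \<open>Y\<^sub>1\<^sub>2\<close> is the resulting off-diagonal block.\<close>

lemma laplacian_interconnection:
  assumes "weighted_graph V\<^sub>1 E\<^sub>1 w" "weighted_graph V\<^sub>2 E\<^sub>2 w" "V\<^sub>1 \<inter> V\<^sub>2 = {}"
    and F: "\<forall>e\<in>F. \<exists>u\<in>V\<^sub>1. \<exists>v\<in>V\<^sub>2. e = {u, v}"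
    and uv: "u \<in> V\<^sub>1" "v \<in> V\<^sub>1"
  shows "laplacian (V\<^sub>1 \<union> V\<^sub>2) (E\<^sub>1 \<union> E\<^sub>2 \<union> F) w u v =
    laplacian V\<^sub>1 E\<^sub>1 w u v +
    (if u = v then - (\<Sum>x \<in> V\<^sub>2. laplacian (V\<^sub>1 \<union> V\<^sub>2) (E\<^sub>1 \<union> E\<^sub>2 \<union> F) w u x) else 0)"
proof -
  have eq: "({u, x} \<in> E\<^sub>1 \<union> E\<^sub>2 \<union> F) = ({u, x} \<in> E\<^sub>1)" if "x \<in> V\<^sub>1" for x
  proof -
    have "{u, x} \<notin> E\<^sub>2"
      using assms(2,3) uv(1) unfolding weighted_graph_def by blast
    moreover have "{u, x} \<notin> F"
    proof
      assume "{u, x} \<in> F"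
      then obtain a b where b: "b \<in> V\<^sub>2" and "{u, x} = {a, b}" using F by meson
      then have "b \<in> {u, x}" by simp
      then have "b \<in> V\<^sub>1" using uv(1) that by auto
      then show False using b assms(3) by auto
    qed
    ultimately show ?thesis by blast
  qed
  let ?y = "\<lambda>x. if {u, x} \<in> E\<^sub>1 \<union> E\<^sub>2 \<union> F then - w {u, x} else 0"
  show ?thesis
  proof (cases "u = v")
    case False
    then show ?thesis using eq[OF uv(2)] by (simp add: laplacian_def)
  next
    case True
    have fin: "finite V\<^sub>1" "finite V\<^sub>2" using assms(1,2) by (auto simp: weighted_graph_def)
    have "(V\<^sub>1 \<union> V\<^sub>2) - {u} = (V\<^sub>1 - {u}) \<union> V\<^sub>2" using assms(3) uv(1) by blast
    then have "sum ?y ((V\<^sub>1 \<union> V\<^sub>2) - {u}) = sum ?y (V\<^sub>1 - {u}) + sum ?y V\<^sub>2"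
      using fin assms(3) by (simp add: sum.union_disjoint Diff_Int_distrib2)
    moreover have "sum ?y (V\<^sub>1 - {u}) = (\<Sum>x \<in> V\<^sub>1 - {u}. if {u, x} \<in> E\<^sub>1 then - w {u, x} else 0)"
      using eq by (intro sum.cong) auto
    moreover have "sum ?y V\<^sub>2 = (\<Sum>x \<in> V\<^sub>2. laplacian (V\<^sub>1 \<union> V\<^sub>2) (E\<^sub>1 \<union> E\<^sub>2 \<union> F) w u x)"
      using assms(3) uv(1) by (intro sum.cong) (auto simp: laplacian_def)
    moreover have "laplacian V E w u u = - (\<Sum>x \<in> V - {u}. if {u, x} \<in> E then - w {u, x} else 0)"
      for V E by (simp add: laplacian_def)
    ultimately show ?thesis unfolding True[symmetric] by simp
  qed
qed

end

theory Submission
  imports Defs "Jordan_Normal_Form.Determinant"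
begin

text \<open>Put \<open>K = D\<^sup>-\<^sup>1 C\<^sup>-\<^sup>1\<close>, so that \<open>C\<^sup>T A\<^sup>-\<^sup>1 b = K b\<close>. The descending path condition makes every leading
  principal block \<open>A\<^sub>i\<close> a nonsingular M-matrix and \<open>A\<^sub>i\<^sup>-\<^sup>1 b\<close> positive; since the \<open>i\<close>-th block of \<open>K b\<close>
  is the last block of \<open>A\<^sub>i\<^sup>-\<^sup>1 b\<close>, this gives \<open>K b > 0\<close>, and block elimination gives \<open>D\<^sup>-\<^sup>1 \<ge> 0\<close> and
  \<open>C\<^sup>-\<^sup>1 \<ge> I\<close>. New edges into the old grid can only increase \<open>b\<close> on \<open>L\<^sub>1\<close>, so the inequality of the
  old grid survives there by monotonicity, and the \<open>L\<^sub>2\<close> part of the new inequality is exactly the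
  hypothesis on \<open>R\<close>. The inequality yields a positive \<open>y\<close> with \<open>A y + [y]\<^sup>-\<^sup>1 P \<le> b\<close>; it remains a
  subsolution when the diagonal of \<open>A\<close> is lowered, and a fixed point argument produces a solution
  above it.\<close>

subsection \<open>Monotone matrices\<close>

text \<open>Why the paths must descend: the condition divides by the entries of \<open>K b\<close>,
  so these must be strictly positive, and block \<open>i\<close> of \<open>K b\<close> is governed
  by the system on the blocks \<open>1, ..., i\<close> alone. A path that leaves through a later
  microgrid says nothing about that system; a descending path never leaves. A load node with an edge
  to a source has both a positive row sum, within any leading block that contains it, and a positive
  entry of \<open>b\<close>. One notion, \<open>grounded\<close>, therefore yields invertibility as
  well as strict positivity. Inverses are controlled through monotonicity (\<open>A x >= 0\<close>
  implies \<open>x >= 0\<close>), which passes to Schur complements without computing any entries.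
  Origin of 1/4: try \<open>C^T y = u - t z\<close>. Then \<open>A y = b - t [u]^-1 c\<close>, and
  \<open>z < u/4\<close> gives \<open>y > (1 - t/4) u\<close>, so this bound makes \<open>y\<close>
  a subsolution if \<open>t (1 - t/4) >= 1\<close>, that is, \<open>(t - 2)^2 <= 0\<close>. The
  constant 1/4 leaves exactly \<open>t = 2\<close>.\<close>

lemma mult_mat_vec_index:
  fixes A :: "'a :: comm_semiring_0 mat"
  assumes "A \<in> carrier_mat nr nc" "x \<in> carrier_vec nc" "i < nr"
  shows "(A *\<^sub>v x) $ i = (\<Sum>j<nc. A $$ (i,j) * x $ j)"
  using assms by (simp add: scalar_prod_def lessThan_atLeast0)

text \<open>A right inverse of a square matrix is two-sided, so \<open>mat_inverse\<close> cannot
  return \<open>None\<close> and \<open>the\<close> in \<open>minv\<close> is applied to a genuine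
  inverse. Every explicit inverse below is obtained by exhibiting a product equal to the
  identity.\<close>

lemma minv_unique:
  assumes A: "A \<in> carrier_mat n n" and B: "B \<in> carrier_mat n n" and AB: "A * B = 1\<^sub>m n"
  shows "minv A = B"
proof -
  have BA: "B * A = 1\<^sub>m n" by (rule mat_mult_left_right_inverse[OF A B AB])
  have "A \<in> Units (ring_mat TYPE(real) n ())"
    unfolding Units_def ring_mat_def using A B AB BA by auto
  then obtain B' where B': "mat_inverse A = Some B'"
    using mat_inverse(1)[OF A, of "()"] by (cases "mat_inverse A") auto
  from mat_inverse(2)[OF A B'] have "A * B' = 1\<^sub>m n" "B' \<in> carrier_mat n n" by auto
  then have "B' = B * A * B'" using BA by simp
  also have "\<dots> = B * (A * B')" by (rule assoc_mult_mat[OF B A \<open>B' \<in> carrier_mat n n\<close>])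
  also have "\<dots> = B" using B \<open>A * B' = 1\<^sub>m n\<close> by simp
  finally have "B' = B" .
  then show ?thesis by (simp add: minv_def B')
qed

text \<open>Outside the invertible matrices \<open>minv\<close> is unspecified, even in its
  dimensions; hence the carrier facts travel together with the two identities.\<close>

definition invertible_dim :: "nat \<Rightarrow> real mat \<Rightarrow> bool" where
  "invertible_dim n A \<longleftrightarrow> A \<in> carrier_mat n n \<and> minv A \<in> carrier_mat n n \<and>
     A * minv A = 1\<^sub>m n \<and> minv A * A = 1\<^sub>m n"

lemma invertible_dimI:
  assumes "A \<in> carrier_mat n n" "B \<in> carrier_mat n n" "A * B = 1\<^sub>m n"
  shows "invertible_dim n A" "minv A = B"
  using minv_unique[OF assms] mat_mult_left_right_inverse[OF assms] assms
  by (auto simp: invertible_dim_def)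

lemma minv_mult:
  assumes "invertible_dim n A" "invertible_dim n B"
  shows "invertible_dim n (A * B)" "minv (A * B) = minv B * minv A"
proof -
  note [simp] = assms[unfolded invertible_dim_def, THEN conjunct1]
  have [simp]: "minv A \<in> carrier_mat n n" "minv B \<in> carrier_mat n n"
    and inv: "A * minv A = 1\<^sub>m n" "B * minv B = 1\<^sub>m n"
    using assms by (auto simp: invertible_dim_def)
  have "A * B * (minv B * minv A) = A * (B * (minv B * minv A))"
    by (rule assoc_mult_mat[of _ n n _ n _ n]) (simp_all add: mult_carrier_mat[of _ n n _ n])
  also have "B * (minv B * minv A) = (B * minv B) * minv A"
    by (rule assoc_mult_mat[of _ n n _ n _ n, symmetric]) auto
  also have "A * \<dots> = 1\<^sub>m n" using inv by (simp add: left_mult_one_mat[of _ n n])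
  finally have *: "A * B * (minv B * minv A) = 1\<^sub>m n" .
  show "invertible_dim n (A * B)" "minv (A * B) = minv B * minv A"
    by (rule invertible_dimI[OF _ _ *]; simp add: mult_carrier_mat[of _ n n _ n])+
qed

lemma invertible_dim_transpose:
  assumes "invertible_dim n A"
  shows "invertible_dim n A\<^sup>T" "minv A\<^sup>T = (minv A)\<^sup>T"
proof -
  have c: "A \<in> carrier_mat n n" "minv A \<in> carrier_mat n n" "minv A * A = 1\<^sub>m n"
    using assms by (auto simp: invertible_dim_def)
  then have "A\<^sup>T * (minv A)\<^sup>T = 1\<^sub>m n"
    by (metis transpose_mult transpose_one)
  from invertible_dimI[OF _ _ this] c
  show "invertible_dim n A\<^sup>T" "minv A\<^sup>T = (minv A)\<^sup>T" by auto
qed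

section \<open>Elementwise order on vectors and matrices\<close>

lemma nonneg_vec_iff: "0\<^sub>v n \<le> (x :: real vec) \<longleftrightarrow> x \<in> carrier_vec n \<and> (\<forall>i<n. 0 \<le> x $ i)"
proof (cases "dim_vec x = n")
  case True
  then show ?thesis unfolding less_eq_vec_def carrier_vec_def by simp
next
  case False
  then have "dim_vec (0\<^sub>v n) \<noteq> dim_vec x" by simp
  with False show ?thesis unfolding less_eq_vec_def carrier_vec_def by blast
qed

lemma pos_vec_iff: "0\<^sub>v n \<lless> x \<longleftrightarrow> x \<in> carrier_vec n \<and> (\<forall>i<n. 0 < x $ i)"
proof (cases "dim_vec x = n")
  case True
  then show ?thesis unfolding vec_less_def carrier_vec_def by simp
next
  case False
  then have "dim_vec (0\<^sub>v n) \<noteq> dim_vec x" by simp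
  with False show ?thesis unfolding vec_less_def carrier_vec_def by blast
qed

lemma nonneg_mat_iff:
  assumes "A \<in> carrier_mat nr nc"
  shows "0\<^sub>m nr nc \<le> (A :: real mat) \<longleftrightarrow> (\<forall>i<nr. \<forall>j<nc. 0 \<le> A $$ (i,j))"
  using assms unfolding less_eq_mat_def by auto

lemma mult_mat_vec_nonneg:
  assumes "A \<in> carrier_mat nr nc" "0\<^sub>m nr nc \<le> A" "0\<^sub>v nc \<le> (x :: real vec)"
  shows "0\<^sub>v nr \<le> A *\<^sub>v x"
proof -
  have x: "x \<in> carrier_vec nc" "\<And>j. j < nc \<Longrightarrow> 0 \<le> x $ j"
    using assms(3) by (auto simp: nonneg_vec_iff)
  have "0 \<le> (A *\<^sub>v x) $ i" if "i < nr" for i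
    unfolding mult_mat_vec_index[OF assms(1) x(1) that]
    using assms(2) x(2) that
    by (intro sum_nonneg mult_nonneg_nonneg) (auto simp: nonneg_mat_iff[OF assms(1)])
  then show ?thesis using mult_mat_vec_carrier[OF assms(1) x(1)] by (simp add: nonneg_vec_iff)
qed

lemma mult_mat_nonneg:
  assumes "A \<in> carrier_mat nr n" "B \<in> carrier_mat n nc" "0\<^sub>m nr n \<le> A" "0\<^sub>m n nc \<le> (B :: real mat)"
  shows "0\<^sub>m nr nc \<le> A * B"
proof -
  have "0 \<le> (A * B) $$ (i,j)" if "i < nr" "j < nc" for i j
  proof -
    have "(A * B) $$ (i,j) = (\<Sum>k<n. A $$ (i,k) * B $$ (k,j))"
      using assms(1,2) that by (simp add: scalar_prod_def lessThan_atLeast0)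
    also have "0 \<le> \<dots>"
      using assms that
      by (intro sum_nonneg mult_nonneg_nonneg) (auto simp: nonneg_mat_iff[of _ nr n] nonneg_mat_iff[of _ n nc])
    finally show ?thesis .
  qed
  then show ?thesis using mult_carrier_mat[OF assms(1,2)] by (simp add: nonneg_mat_iff)
qed

lemma mult_mat_vec_mono:
  assumes "A \<in> carrier_mat nr nc" "0\<^sub>m nr nc \<le> A" "x \<in> carrier_vec nc" "y \<in> carrier_vec nc"
    and "x \<le> (y :: real vec)"
  shows "A *\<^sub>v x \<le> A *\<^sub>v y"
proof -
  have "(A *\<^sub>v x) $ i \<le> (A *\<^sub>v y) $ i" if "i < nr" for i
    unfolding mult_mat_vec_index[OF assms(1,3) that] mult_mat_vec_index[OF assms(1,4) that]
    using assms(2,4,5) that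
    by (intro sum_mono mult_left_mono) (auto simp: nonneg_mat_iff[OF assms(1)] less_eq_vec_def)
  then show ?thesis using assms(1) by (simp add: less_eq_vec_def)
qed

text \<open>Collatz's form of inverse-nonnegativity; a Z-matrix with this property is a nonsingular
  M-matrix. The form without an inverse is the one that a minimum principle proves directly.\<close>

definition monotone_mat :: "nat \<Rightarrow> real mat \<Rightarrow> bool" where
  "monotone_mat n A \<longleftrightarrow> A \<in> carrier_mat n n \<and>
     (\<forall>x \<in> carrier_vec n. 0\<^sub>v n \<le> A *\<^sub>v x \<longrightarrow> 0\<^sub>v n \<le> x)"

text \<open>A kernel vector \<open>v\<close> and its negative are both mapped to 0, so both are
  nonnegative and \<open>v = 0\<close>. Column \<open>j\<close> of the inverse is nonnegative
  because \<open>A\<close> maps it to a unit vector.\<close>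

lemma monotone_mat_invertible:
  assumes "monotone_mat n A"
  shows "invertible_dim n A" "0\<^sub>m n n \<le> minv A"
proof -
  have A: "A \<in> carrier_mat n n"
    and mono: "\<And>x. x \<in> carrier_vec n \<Longrightarrow> 0\<^sub>v n \<le> A *\<^sub>v x \<Longrightarrow> 0\<^sub>v n \<le> x"
    using assms by (auto simp: monotone_mat_def)
  have "det A \<noteq> 0"
  proof
    assume "det A = 0"
    then obtain v where v: "v \<in> carrier_vec n" "v \<noteq> 0\<^sub>v n" "A *\<^sub>v v = 0\<^sub>v n"
      using det_0_iff_vec_prod_zero[OF A] by auto
    have "A *\<^sub>v (- v) = - (A *\<^sub>v v)" using v(1) A by (intro eq_vecI) simp_all
    then have "A *\<^sub>v (- v) = 0\<^sub>v n" using v(3) by simp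
    then have "0\<^sub>v n \<le> v" "0\<^sub>v n \<le> - v" using mono v by auto
    then have "v = 0\<^sub>v n" by (intro eq_vecI) (auto simp: nonneg_vec_iff intro: antisym)
    with v(2) show False by simp
  qed
  then have "A \<in> Units (ring_mat TYPE(real) n ())" by (rule det_non_zero_imp_unit[OF A])
  then obtain B where "mat_inverse A = Some B"
    using mat_inverse(1)[OF A, of "()"] by (cases "mat_inverse A") auto
  then have inv: "A * minv A = 1\<^sub>m n" "minv A \<in> carrier_mat n n"
    using mat_inverse(2)[OF A] by (auto simp: minv_def)
  then show "invertible_dim n A" using invertible_dimI(1)[OF A] by blast
  have "0 \<le> minv A $$ (i,j)" if "i < n" "j < n" for i j
  proof -
    have "A *\<^sub>v col (minv A) j = col (A * minv A) j"
      using col_mult2[OF A inv(2) that(2)] by simp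
    also have "\<dots> = unit_vec n j" using inv that by simp
    finally have "0\<^sub>v n \<le> col (minv A) j"
      using mono[of "col (minv A) j"] inv(2) that
      by (auto simp: nonneg_vec_iff unit_vec_def)
    then show ?thesis using inv(2) that by (auto simp: nonneg_vec_iff)
  qed
  then show "0\<^sub>m n n \<le> minv A" using inv(2) by (simp add: nonneg_mat_iff)
qed

lemma minv_mult_vec:
  assumes "invertible_dim n A" "x \<in> carrier_vec n"
  shows "A *\<^sub>v (minv A *\<^sub>v x) = x" "minv A *\<^sub>v (A *\<^sub>v x) = x"
proof -
  have "A \<in> carrier_mat n n" "minv A \<in> carrier_mat n n"
    and inv: "A * minv A = 1\<^sub>m n" "minv A * A = 1\<^sub>m n"
    using assms by (auto simp: invertible_dim_def)
  then show "A *\<^sub>v (minv A *\<^sub>v x) = x" "minv A *\<^sub>v (A *\<^sub>v x) = x"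
    using assoc_mult_mat_vec[of A n n "minv A" n x] assoc_mult_mat_vec[of "minv A" n n A n x]
      assms(2) by simp_all
qed

section \<open>Z-matrices and minimum principles\<close>

definition Z_matrix :: "nat \<Rightarrow> real mat \<Rightarrow> bool" where
  "Z_matrix n A \<longleftrightarrow> A \<in> carrier_mat n n \<and> (\<forall>i<n. \<forall>j<n. i \<noteq> j \<longrightarrow> A $$ (i,j) \<le> 0)"

text \<open>In the matrix digraph of \<open>A\<close> restricted to the first \<open>N\<close> indices, every index leads to one at
  which both the row sum and \<open>b\<close> are positive.\<close>

definition grounded :: "nat \<Rightarrow> real mat \<Rightarrow> real vec \<Rightarrow> bool" where
  "grounded N A b \<longleftrightarrow>
     (\<forall>Q \<subseteq> {..<N}. Q \<noteq> {} \<longrightarrow> (\<forall>i\<in>Q. \<forall>j<N. A $$ (i,j) \<noteq> 0 \<longrightarrow> j \<in> Q) \<longrightarrow>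
        (\<exists>i\<in>Q. 0 < (\<Sum>j<N. A $$ (i,j)) \<and> 0 < b $ i))"

text \<open>Minimum principle: the indices at which \<open>x\<close> attains a negative minimum are closed under
  adjacency and have row sum zero.\<close>

lemma grounded_monotone_mat:
  assumes Z: "Z_matrix n A" and rs: "\<And>i. i < n \<Longrightarrow> 0 \<le> (\<Sum>j<n. A $$ (i,j))"
    and gr: "grounded n A b"
  shows "monotone_mat n A"
  unfolding monotone_mat_def
proof (intro conjI ballI impI)
  show A: "A \<in> carrier_mat n n" using Z by (simp add: Z_matrix_def)
  fix x assume x: "x \<in> carrier_vec n" and Ax: "0\<^sub>v n \<le> A *\<^sub>v x"
  show "0\<^sub>v n \<le> x"
  proof (rule ccontr)
    assume "\<not> 0\<^sub>v n \<le> x"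
    then obtain i0 where i0: "i0 < n" "x $ i0 < 0" using x by (auto simp: nonneg_vec_iff not_le)
    define m where "m = Min ((\<lambda>i. x $ i) ` {..<n})"
    define Q where "Q = {i. i < n \<and> x $ i = m}"
    have m_le: "m \<le> x $ i" if "i < n" for i using that by (auto simp: m_def)
    have "m < 0" using m_le[OF i0(1)] i0 by simp
    have "m \<in> (\<lambda>i. x $ i) ` {..<n}" unfolding m_def using i0(1) by (intro Min_in) auto
    then have "Q \<noteq> {}" by (auto simp: Q_def)
    have at_min: "m * (\<Sum>j<n. A $$ (i,j)) = 0 \<and> (\<forall>j<n. A $$ (i,j) * (x $ j - m) = 0)"
      if i: "i \<in> Q" for i
    proof -
      have i': "i < n" "x $ i = m" using i by (auto simp: Q_def)
      have np: "A $$ (i,j) * (x $ j - m) \<le> 0" if "j < n" for j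
        using Z i' m_le[OF that] that
        by (cases "j = i") (auto simp: Z_matrix_def intro: mult_nonpos_nonneg)
      have "0 \<le> (A *\<^sub>v x) $ i" using Ax i'(1) by (simp only: nonneg_vec_iff)
      also have "\<dots> = (\<Sum>j<n. A $$ (i,j) * x $ j)" by (rule mult_mat_vec_index[OF A x i'(1)])
      \<comment> \<open>Write \<open>x $ j = m + (x $ j - m)\<close>. At an index of
        \<open>Q\<close> both resulting sums are nonpositive while their total is nonnegative, so
        both vanish, the second one term by term.\<close>
      also have "\<dots> = m * (\<Sum>j<n. A $$ (i,j)) + (\<Sum>j<n. A $$ (i,j) * (x $ j - m))"
        by (simp add: algebra_simps sum.distrib sum_subtractf sum_distrib_left)
      finally have "0 \<le> m * (\<Sum>j<n. A $$ (i,j)) + (\<Sum>j<n. A $$ (i,j) * (x $ j - m))" .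
      moreover have "m * (\<Sum>j<n. A $$ (i,j)) \<le> 0"
        using rs[OF i'(1)] \<open>m < 0\<close> by (simp add: mult_nonpos_nonneg)
      moreover have "(\<Sum>j<n. A $$ (i,j) * (x $ j - m)) \<le> 0" using np by (intro sum_nonpos) auto
      ultimately have "m * (\<Sum>j<n. A $$ (i,j)) = 0" "(\<Sum>j<n. A $$ (i,j) * (x $ j - m)) = 0"
        by linarith+
      then have "m * (\<Sum>j<n. A $$ (i,j)) = 0" "(\<Sum>j<n. - (A $$ (i,j) * (x $ j - m))) = 0"
        by (simp_all only: sum_negf)
      moreover from this(2) have "\<forall>j\<in>{..<n}. - (A $$ (i,j) * (x $ j - m)) = 0"
        using np by (subst (asm) sum_nonneg_eq_0_iff) auto
      ultimately show ?thesis by auto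
    qed
    then have "\<forall>i\<in>Q. \<forall>j<n. A $$ (i,j) \<noteq> 0 \<longrightarrow> j \<in> Q" by (auto simp: Q_def)
    moreover have "Q \<subseteq> {..<n}" by (auto simp: Q_def)
    ultimately obtain i where "i \<in> Q" "0 < (\<Sum>j<n. A $$ (i,j))"
      using gr \<open>Q \<noteq> {}\<close> unfolding grounded_def by meson
    with at_min[of i] \<open>m < 0\<close> show False by simp
  qed
qed

text \<open>The minimum principle at the value 0: in a row where \<open>x\<close> vanishes all
  summands of \<open>A x\<close> are nonpositive, yet they add up to \<open>b $ i >= 0\<close>, so
  all of them are 0. The zero set of \<open>x\<close> is thus closed under adjacency and
  \<open>b\<close> vanishes on it, which \<open>grounded\<close> excludes unless the set is
  empty.\<close>

lemma grounded_solution_pos: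
  assumes Z: "Z_matrix n A" and gr: "grounded n A b" and b: "b \<in> carrier_vec n" "0\<^sub>v n \<le> b"
    and x: "x \<in> carrier_vec n" "0\<^sub>v n \<le> x" and Ax: "A *\<^sub>v x = b"
  shows "0\<^sub>v n \<lless> x"
proof -
  define Q where "Q = {i. i < n \<and> x $ i = 0}"
  have A: "A \<in> carrier_mat n n" using Z by (simp add: Z_matrix_def)
  have x0: "0 \<le> x $ i" if "i < n" for i using x that by (simp add: nonneg_vec_iff)
  have at0: "b $ i = 0 \<and> (\<forall>j<n. A $$ (i,j) * x $ j = 0)" if i: "i \<in> Q" for i
  proof -
    have i': "i < n" "x $ i = 0" using i by (auto simp: Q_def)
    have np: "A $$ (i,j) * x $ j \<le> 0" if "j < n" for j
      using Z i' x0[OF that] that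
      by (cases "j = i") (auto simp: Z_matrix_def intro: mult_nonpos_nonneg)
    have eq: "b $ i = (\<Sum>j<n. A $$ (i,j) * x $ j)"
      using mult_mat_vec_index[OF A x(1) i'(1)] Ax by simp
    have "0 \<le> b $ i" using b i' by (simp add: nonneg_vec_iff)
    moreover have "(\<Sum>j<n. A $$ (i,j) * x $ j) \<le> 0" using np by (intro sum_nonpos) auto
    ultimately have z: "b $ i = 0" "(\<Sum>j<n. - (A $$ (i,j) * x $ j)) = 0"
      using eq by (simp_all add: sum_negf)
    from z(2) have "\<forall>j\<in>{..<n}. - (A $$ (i,j) * x $ j) = 0"
      using np by (subst (asm) sum_nonneg_eq_0_iff) auto
    with z show ?thesis by auto
  qed
  then have "\<forall>i\<in>Q. \<forall>j<n. A $$ (i,j) \<noteq> 0 \<longrightarrow> j \<in> Q" by (auto simp: Q_def)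
  moreover have "\<not> (\<exists>i\<in>Q. 0 < b $ i)" using at0 by force
  moreover have "Q \<subseteq> {..<n}" by (auto simp: Q_def)
  ultimately have "Q = {}" using gr unfolding grounded_def by meson
  then have "0 < x $ i" if "i < n" for i using x0[OF that] that by (auto simp: Q_def less_le)
  then show ?thesis using x(1) by (simp add: pos_vec_iff)
qed

subsection \<open>Block elimination\<close>

lemma carrier_invertible_dim:
  "invertible_dim n A \<Longrightarrow> A \<in> carrier_mat n n" "invertible_dim n A \<Longrightarrow> minv A \<in> carrier_mat n n"
  by (simp_all add: invertible_dim_def)

lemma four_block_mat_nonneg:
  assumes "A \<in> carrier_mat n n" "B \<in> carrier_mat n p" "C \<in> carrier_mat p n" "D \<in> carrier_mat p p"
    and "0\<^sub>m n n \<le> (A :: real mat)" "0\<^sub>m n p \<le> B" "0\<^sub>m p n \<le> C" "0\<^sub>m p p \<le> D"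
  shows "0\<^sub>m (n + p) (n + p) \<le> four_block_mat A B C D"
proof -
  have "four_block_mat A B C D \<in> carrier_mat (n + p) (n + p)" using assms by simp
  then show ?thesis
    using assms(5-8) by (auto simp: nonneg_mat_iff[OF assms(1)] nonneg_mat_iff[OF assms(2)]
        nonneg_mat_iff[OF assms(3)] nonneg_mat_iff[OF assms(4)] nonneg_mat_iff
        carrier_matD[OF assms(1)] carrier_matD[OF assms(4)])
qed

lemma vec_diff_add_cancel:
  "u \<in> carrier_vec n \<Longrightarrow> v \<in> carrier_vec n \<Longrightarrow> u - v + v = (u :: 'a :: ab_group_add vec)"
  by (auto intro: eq_vecI)

lemma vec_uminus_add:
  "u \<in> carrier_vec n \<Longrightarrow> v \<in> carrier_vec n \<Longrightarrow> - u + v = (v - u :: 'a :: ab_group_add vec)"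
  by (auto intro: eq_vecI)

lemma vec_diff_add_commute:
  "u \<in> carrier_vec n \<Longrightarrow> v \<in> carrier_vec n \<Longrightarrow> w \<in> carrier_vec n \<Longrightarrow>
    u - v + w = (u + (w - v) :: 'a :: ab_group_add vec)"
  by (auto intro: eq_vecI)

lemma append_vec_pos:
  assumes "0\<^sub>v n \<lless> u" "0\<^sub>v p \<lless> v"
  shows "0\<^sub>v (n + p) \<lless> u @\<^sub>v v"
  using assms by (auto simp: pos_vec_iff)

lemma append_vec_nonneg:
  assumes "0\<^sub>v n \<le> (u :: real vec)" "0\<^sub>v p \<le> v"
  shows "0\<^sub>v (n + p) \<le> u @\<^sub>v v"
  using assms by (auto simp: nonneg_vec_iff)

lemma zero_mat_mult_vec:
  "v \<in> carrier_vec nc \<Longrightarrow> 0\<^sub>m nr nc *\<^sub>v v = (0\<^sub>v nr :: 'a :: comm_semiring_0 vec)"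
  by (auto intro!: eq_vecI simp: scalar_prod_def)

lemma mult_mat_zero_vec:
  "A \<in> carrier_mat nr nc \<Longrightarrow> A *\<^sub>v 0\<^sub>v nc = (0\<^sub>v nr :: 'a :: comm_semiring_0 vec)"
  by (auto intro!: eq_vecI simp: scalar_prod_def)

text \<open>The lower left block of a BCD factor has the shape \<open>K * C\<close> with
  \<open>K\<close> standing for \<open>alpha A^-1\<close>. The trailing \<open>C\<close> cancels
  against \<open>minv C\<close>, so the inverse contains just \<open>- K\<close>, whose sign is
  known.\<close>

lemma block_lower_triangular_inverse:
  assumes "invertible_dim n C" and K: "K \<in> carrier_mat p n"
  shows "invertible_dim (n + p) (four_block_mat C (0\<^sub>m n p) (K * C) (1\<^sub>m p))"
    "minv (four_block_mat C (0\<^sub>m n p) (K * C) (1\<^sub>m p)) =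
      four_block_mat (minv C) (0\<^sub>m n p) (- K) (1\<^sub>m p)"
proof -
  let ?M = "four_block_mat C (0\<^sub>m n p) (K * C) (1\<^sub>m p)"
  let ?I = "four_block_mat (minv C) (0\<^sub>m n p) (- K) (1\<^sub>m p)"
  have C: "C \<in> carrier_mat n n" "minv C \<in> carrier_mat n n" and inv: "C * minv C = 1\<^sub>m n"
    using assms(1) by (auto simp: invertible_dim_def)
  have "K * C * minv C = K"
    using K C by (simp add: assoc_mult_mat[of _ p n _ n _ n] inv)
  moreover have "K * C \<in> carrier_mat p n" using K C by simp
  moreover have "K + - K = 0\<^sub>m p n" using K by auto
  moreover have "0\<^sub>m n p * - K = 0\<^sub>m n n" using left_mult_zero_mat[of "- K" p n n] K by simp
  ultimately have "?M * ?I = 1\<^sub>m (n + p)"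
    using C K inv
    by (subst mult_four_block_mat[of _ n n _ p _ p _ _ n _ p]) (simp_all del: uminus_mult_right_mat)
  from invertible_dimI[OF _ _ this] C K
  show "invertible_dim (n + p) ?M" "minv ?M = ?I" by auto
qed

lemma block_diagonal_inverse:
  assumes "invertible_dim n D" "invertible_dim p S"
  shows "invertible_dim (n + p) (four_block_mat D (0\<^sub>m n p) (0\<^sub>m p n) S)"
    "minv (four_block_mat D (0\<^sub>m n p) (0\<^sub>m p n) S) =
      four_block_mat (minv D) (0\<^sub>m n p) (0\<^sub>m p n) (minv S)"
proof -
  let ?M = "four_block_mat D (0\<^sub>m n p) (0\<^sub>m p n) S"
  let ?I = "four_block_mat (minv D) (0\<^sub>m n p) (0\<^sub>m p n) (minv S)"
  have c: "D \<in> carrier_mat n n" "minv D \<in> carrier_mat n n" "S \<in> carrier_mat p p" "minv S \<in> carrier_mat p p"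
    and "D * minv D = 1\<^sub>m n" "S * minv S = 1\<^sub>m p"
    using assms by (auto simp: invertible_dim_def)
  then have "?M * ?I = 1\<^sub>m (n + p)"
    by (subst mult_four_block_mat[of _ n n _ p _ p _ _ n _ p]) simp_all
  from invertible_dimI[OF _ _ this] c
  show "invertible_dim (n + p) ?M" "minv ?M = ?I" by auto
qed

text \<open>After multiplying out, \<open>C * D * C\<^sup>T\<close> can be replaced by
  \<open>A\<close> in every block. What remains are the equations \<open>eqs\<close>, which hold
  when \<open>K\<close> is \<open>B A^-1\<close> and \<open>S\<close> is the Schur
  complement.\<close>

lemma block_LDL_product:
  assumes C: "(C :: real mat) \<in> carrier_mat n n" and D: "D \<in> carrier_mat n n" and CDC: "C * D * C\<^sup>T = A"
    and K: "K \<in> carrier_mat p n" and S: "S \<in> carrier_mat p p"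
    and eqs: "K * A = B" "A * K\<^sup>T = B\<^sup>T" "B * K\<^sup>T + S = G"
  shows "four_block_mat C (0\<^sub>m n p) (K * C) (1\<^sub>m p) * four_block_mat D (0\<^sub>m n p) (0\<^sub>m p n) S *
    (four_block_mat C (0\<^sub>m n p) (K * C) (1\<^sub>m p))\<^sup>T = four_block_mat A B\<^sup>T B G"
proof -
  let ?C = "four_block_mat C (0\<^sub>m n p) (K * C) (1\<^sub>m p)"
  let ?D = "four_block_mat D (0\<^sub>m n p) (0\<^sub>m p n) S"
  have KC: "K * C \<in> carrier_mat p n" using K C by simp
  have CT: "(K * C)\<^sup>T = C\<^sup>T * K\<^sup>T" by (rule transpose_mult[OF K C])
  have "?C * ?D = four_block_mat (C * D) (0\<^sub>m n p) (K * C * D) S"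
    using C D K KC S by (subst mult_four_block_mat[of _ n n _ p _ p _ _ n _ p]) simp_all
  moreover have "?C\<^sup>T = four_block_mat C\<^sup>T (K * C)\<^sup>T (0\<^sub>m p n) (1\<^sub>m p)"
    using C KC by (subst transpose_four_block_mat[of _ n n _ p _ p]) simp_all
  ultimately have "?C * ?D * ?C\<^sup>T =
      four_block_mat (C * D) (0\<^sub>m n p) (K * C * D) S *
      four_block_mat C\<^sup>T (K * C)\<^sup>T (0\<^sub>m p n) (1\<^sub>m p)" by simp
  also have "\<dots> = four_block_mat (C * D * C\<^sup>T) (C * D * (K * C)\<^sup>T)
      (K * C * D * C\<^sup>T) (K * C * D * (K * C)\<^sup>T + S)"
    using C D KC S by (subst mult_four_block_mat[of _ n n _ p _ p _ _ n _ p]) simp_all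
  also have "C * D * (K * C)\<^sup>T = C * D * C\<^sup>T * K\<^sup>T"
    unfolding CT using C D K by (simp add: assoc_mult_mat[of _ n n _ n _ p])
  also have "\<dots> = B\<^sup>T" unfolding CDC by (rule eqs(2))
  also have KCDC: "K * C * D * C\<^sup>T = K * (C * D * C\<^sup>T)"
    using C D K by (simp add: assoc_mult_mat[of _ p n _ n _ n] assoc_mult_mat[of _ n n _ n _ n])
  also have "\<dots> = B" unfolding CDC by (rule eqs(1))
  also have "K * C * D * (K * C)\<^sup>T = K * C * D * C\<^sup>T * K\<^sup>T"
    unfolding CT using C D K by (simp add: assoc_mult_mat[of _ p n _ n _ p])
  also have "\<dots> = B * K\<^sup>T" unfolding KCDC CDC eqs(1) ..
  also have "B * K\<^sup>T + S = G" by (rule eqs(3))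
  also have "C * D * C\<^sup>T = A" by (rule CDC)
  finally show ?thesis .
qed

text \<open>The invariant of the induction over blocks. The bound is on
  \<open>minv C - 1\<^sub>m n\<close>, stronger than nonnegativity of \<open>minv C\<close>, because
  the subsolution needs \<open>C^-T s >= s\<close> for \<open>s >= 0\<close>. The last conjunct is
  the positivity of \<open>C^T A^-1 b\<close>.\<close>

definition bcd_factors :: "nat \<Rightarrow> real mat \<Rightarrow> real vec \<Rightarrow> real mat \<Rightarrow> real mat \<Rightarrow> bool" where
  "bcd_factors n A b C D \<longleftrightarrow> invertible_dim n C \<and> invertible_dim n D \<and> C * D * C\<^sup>T = A \<and>
     0\<^sub>m n n \<le> minv C - 1\<^sub>m n \<and> 0\<^sub>m n n \<le> minv D \<and> 0\<^sub>v n \<lless> minv D * minv C *\<^sub>v b"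

lemma bcd_factors_minv_nonneg:
  assumes "bcd_factors n A b C D"
  shows "0\<^sub>m n n \<le> minv C" "0\<^sub>m n n \<le> minv D * minv C"
proof -
  have c: "minv C \<in> carrier_mat n n" "minv D \<in> carrier_mat n n"
    and "0\<^sub>m n n \<le> minv C - 1\<^sub>m n" and D: "0\<^sub>m n n \<le> minv D"
    using assms by (auto simp: bcd_factors_def invertible_dim_def)
  then have "0 \<le> (minv C - 1\<^sub>m n) $$ (i,j)" if "i < n" "j < n" for i j
    using that nonneg_mat_iff[of "minv C - 1\<^sub>m n" n n] by (simp add: minus_carrier_mat)
  then have "0 \<le> minv C $$ (i,j)" if "i < n" "j < n" for i j
    using that c by (force split: if_splits)
  then show C: "0\<^sub>m n n \<le> minv C" using c by (simp add: nonneg_mat_iff)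
  show "0\<^sub>m n n \<le> minv D * minv C" by (rule mult_mat_nonneg[OF c(2,1) D C])
qed

text \<open>Bordering \<open>A\<close> by one more block. It serves twice: for each step of the
  induction over blocks, and for attaching the new microgrid to the whole old grid.\<close>

locale schur_step =
  fixes n p :: nat and A B G :: "real mat"
  assumes mono: "monotone_mat n A" and sym: "A\<^sup>T = A"
    and B: "B \<in> carrier_mat p n" and B_nonpos: "0\<^sub>m p n \<le> - B" and G: "G \<in> carrier_mat p p"
    and mono': "monotone_mat (n + p) (four_block_mat A B\<^sup>T B G)"
begin

abbreviation "S \<equiv> G - B * minv A * B\<^sup>T"

lemma A: "A \<in> carrier_mat n n" "minv A \<in> carrier_mat n n" "A * minv A = 1\<^sub>m n" "minv A * A = 1\<^sub>m n"
  using monotone_mat_invertible(1)[OF mono] by (auto simp: invertible_dim_def)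

lemma BA: "B * minv A \<in> carrier_mat p n" "B * minv A * A = B" "A * (B * minv A)\<^sup>T = B\<^sup>T"
  "B * (B * minv A)\<^sup>T = B * minv A * B\<^sup>T"
proof -
  show c: "B * minv A \<in> carrier_mat p n" using A B by simp
  show eq: "B * minv A * A = B" using A B by (simp add: assoc_mult_mat[of _ p n _ n _ n])
  have "A * (B * minv A)\<^sup>T = (B * minv A * A)\<^sup>T"
    by (simp add: transpose_mult[OF c A(1)] sym)
  then show "A * (B * minv A)\<^sup>T = B\<^sup>T" by (simp add: eq)
  have "(minv A)\<^sup>T = minv A"
    using invertible_dim_transpose(2)[OF monotone_mat_invertible(1)[OF mono]] sym by simp
  then have "(B * minv A)\<^sup>T = minv A * B\<^sup>T" by (simp add: transpose_mult[OF B A(2)])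
  then show "B * (B * minv A)\<^sup>T = B * minv A * B\<^sup>T"
    using A B by (simp add: assoc_mult_mat[of _ p n _ n _ p])
qed

lemma S: "S \<in> carrier_mat p p"
  using BA(1) B G by (simp add: minus_carrier_mat)

text \<open>The lower part \<open>x\<close> is prescribed and the upper part is chosen to solve the
  first block row for the right-hand side \<open>f\<close>. With \<open>f = 0\<close> this gives
  monotonicity of \<open>S\<close>; with \<open>f = b\<^sub>1\<close> it identifies the lower part
  of the full solution.\<close>

lemma block_elimination:
  assumes f: "f \<in> carrier_vec n" and x: "x \<in> carrier_vec p"
  shows "four_block_mat A B\<^sup>T B G *\<^sub>v ((minv A *\<^sub>v (f - B\<^sup>T *\<^sub>v x)) @\<^sub>v x) =
    f @\<^sub>v (B * minv A *\<^sub>v f + S *\<^sub>v x)"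
proof -
  let ?g = "B\<^sup>T *\<^sub>v x"
  have g: "?g \<in> carrier_vec n" "f - ?g \<in> carrier_vec n" using B f x by auto
  have "A *\<^sub>v (minv A *\<^sub>v (f - ?g)) + ?g = f"
    unfolding minv_mult_vec(1)[OF monotone_mat_invertible(1)[OF mono] g(2)]
    by (rule vec_diff_add_cancel[OF f g(1)])
  moreover have "B *\<^sub>v (minv A *\<^sub>v (f - ?g)) + G *\<^sub>v x = B * minv A *\<^sub>v f + S *\<^sub>v x"
  proof -
    have "B *\<^sub>v (minv A *\<^sub>v (f - ?g)) = B * minv A *\<^sub>v (f - ?g)"
      using assoc_mult_mat_vec[OF B A(2) g(2)] by simp
    also have "\<dots> = B * minv A *\<^sub>v f - B * minv A *\<^sub>v ?g"
      by (rule mult_minus_distrib_mat_vec[OF BA(1) f g(1)])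
    also have "B * minv A *\<^sub>v ?g = B * minv A * B\<^sup>T *\<^sub>v x"
      using assoc_mult_mat_vec[OF BA(1) _ x, of "B\<^sup>T"] B by simp
    moreover have "S *\<^sub>v x = G *\<^sub>v x - B * minv A * B\<^sup>T *\<^sub>v x"
      by (rule minus_mult_distrib_mat_vec[OF G _ x]) (use BA(1) B in simp)
    moreover have "B * minv A *\<^sub>v f \<in> carrier_vec p" "B * minv A * B\<^sup>T *\<^sub>v x \<in> carrier_vec p"
        "G *\<^sub>v x \<in> carrier_vec p"
      using BA(1) B G f x by (auto intro!: mult_mat_vec_carrier)
    ultimately show ?thesis by (simp only: vec_diff_add_commute[of _ p])
  qed
  ultimately show ?thesis
    using four_block_mat_mult_vec[OF A(1) _ B G _ x, of "B\<^sup>T" "minv A *\<^sub>v (f - ?g)"] A B g by simp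
qed

text \<open>Eliminating with upper right-hand side 0 extends \<open>x\<close> to a vector that the
  bordered matrix maps to \<open>(0, S x)\<close>. If \<open>S x >= 0\<close>, monotonicity of the
  bordered matrix makes the extension, and hence \<open>x\<close>, nonnegative.\<close>

lemma S_monotone: "monotone_mat p S"
  unfolding monotone_mat_def
proof (intro conjI S ballI impI)
  fix x assume x: "x \<in> carrier_vec p" and Sx: "0\<^sub>v p \<le> S *\<^sub>v x"
  let ?X = "(minv A *\<^sub>v (0\<^sub>v n - B\<^sup>T *\<^sub>v x)) @\<^sub>v x"
  have "B * minv A *\<^sub>v 0\<^sub>v n = 0\<^sub>v p" by (rule mult_mat_zero_vec[OF BA(1)])
  moreover have "S *\<^sub>v x \<in> carrier_vec p" by (rule mult_mat_vec_carrier[OF S x])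
  ultimately have "B * minv A *\<^sub>v 0\<^sub>v n + S *\<^sub>v x = S *\<^sub>v x" by simp
  then have "four_block_mat A B\<^sup>T B G *\<^sub>v ?X = 0\<^sub>v n @\<^sub>v (S *\<^sub>v x)"
    using block_elimination[OF zero_carrier_vec x] by simp
  moreover have "0\<^sub>v (n + p) \<le> 0\<^sub>v n @\<^sub>v (S *\<^sub>v x)"
    by (rule append_vec_nonneg[OF _ Sx]) (simp add: nonneg_vec_iff)
  moreover have X: "?X \<in> carrier_vec (n + p)" using A B x by auto
  ultimately have "0\<^sub>v (n + p) \<le> ?X" using mono' by (simp add: monotone_mat_def)
  then have nn: "0 \<le> ?X $ (n + i)" if "i < p" for i using that by (simp add: nonneg_vec_iff)
  have "?X $ (n + i) = x $ i" if "i < p" for i using that x A by simp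
  with nn show "0\<^sub>v p \<le> x" using x by (simp add: nonneg_vec_iff)
qed

lemma S_inv: "minv S \<in> carrier_mat p p" "S * minv S = 1\<^sub>m p" "0\<^sub>m p p \<le> minv S"
  using monotone_mat_invertible[OF S_monotone] by (auto simp: invertible_dim_def)

context
  fixes b\<^sub>1 b\<^sub>2 :: "real vec" and C D :: "real mat"
  assumes fac: "bcd_factors n A b\<^sub>1 C D"
begin

abbreviation "C' \<equiv> four_block_mat C (0\<^sub>m n p) (B * minv A * C) (1\<^sub>m p)"
abbreviation "D' \<equiv> four_block_mat D (0\<^sub>m n p) (0\<^sub>m p n) S"

lemma CD: "C \<in> carrier_mat n n" "minv C \<in> carrier_mat n n" "C * minv C = 1\<^sub>m n"
  "D \<in> carrier_mat n n" "minv D \<in> carrier_mat n n" "D * minv D = 1\<^sub>m n" "C * D * C\<^sup>T = A"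
  using fac by (auto simp: bcd_factors_def invertible_dim_def)

lemma C'_inv:
  "invertible_dim (n + p) C'"
  "minv C' = four_block_mat (minv C) (0\<^sub>m n p) (- (B * minv A)) (1\<^sub>m p)"
  using block_lower_triangular_inverse[OF _ BA(1)] fac by (simp_all add: bcd_factors_def)

lemma D'_inv:
  "invertible_dim (n + p) D'"
  "minv D' = four_block_mat (minv D) (0\<^sub>m n p) (0\<^sub>m p n) (minv S)"
  using block_diagonal_inverse[OF _ monotone_mat_invertible(1)[OF S_monotone]] fac
  by (simp_all add: bcd_factors_def)

lemma C'_D'_product: "C' * D' * C'\<^sup>T = four_block_mat A B\<^sup>T B G"
proof (rule block_LDL_product[OF CD(1,4,7) BA(1) S BA(2,3)])
  show "B * (B * minv A)\<^sup>T + S = G" unfolding BA(4) using BA(1) B G by (auto intro!: eq_matI)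
qed

text \<open>Both inverses are block lower triangular, so the upper part of the result depends on
  \<open>v\<^sub>1\<close> alone and through the old factors. Hence a new microgrid affects the old
  part of the condition only through the changed source vector.\<close>

lemma step_mult_vec:
  assumes v: "v\<^sub>1 \<in> carrier_vec n" "v\<^sub>2 \<in> carrier_vec p"
  shows "minv D' * minv C' *\<^sub>v (v\<^sub>1 @\<^sub>v v\<^sub>2) =
    (minv D * minv C *\<^sub>v v\<^sub>1) @\<^sub>v (minv S *\<^sub>v (v\<^sub>2 - B * minv A *\<^sub>v v\<^sub>1))"
proof -
  let ?K = "B * minv A"
  note c = CD(2,5) S_inv(1) BA(1)
  have eq: "- ?K *\<^sub>v v\<^sub>1 + v\<^sub>2 = v\<^sub>2 - ?K *\<^sub>v v\<^sub>1"
  proof -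
    have "- ?K *\<^sub>v v\<^sub>1 = - (?K *\<^sub>v v\<^sub>1)" using uminus_mult_mat_vec[of v\<^sub>1 ?K] v c by auto
    then show ?thesis using vec_uminus_add[OF mult_mat_vec_carrier[OF BA(1) v(1)] v(2)] by simp
  qed
  have m: "minv D' \<in> carrier_mat (n + p) (n + p)" "minv C' \<in> carrier_mat (n + p) (n + p)"
    unfolding D'_inv(2) C'_inv(2) using c by auto
  have "minv D' * minv C' *\<^sub>v (v\<^sub>1 @\<^sub>v v\<^sub>2) = minv D' *\<^sub>v (minv C' *\<^sub>v (v\<^sub>1 @\<^sub>v v\<^sub>2))"
    by (rule assoc_mult_mat_vec[OF m]) (use v in simp)
  also have "minv C' *\<^sub>v (v\<^sub>1 @\<^sub>v v\<^sub>2) = (minv C *\<^sub>v v\<^sub>1) @\<^sub>v (v\<^sub>2 - ?K *\<^sub>v v\<^sub>1)"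
    unfolding C'_inv(2) using v c eq
    by (subst four_block_mat_mult_vec[of _ n n _ p _ p]) (simp_all add: zero_mat_mult_vec)
  also have "minv D' *\<^sub>v \<dots> = (minv D *\<^sub>v (minv C *\<^sub>v v\<^sub>1)) @\<^sub>v (minv S *\<^sub>v (v\<^sub>2 - ?K *\<^sub>v v\<^sub>1))"
    unfolding D'_inv(2) using v c
    by (subst four_block_mat_mult_vec[of _ n n _ p _ p]) (simp_all add: zero_mat_mult_vec)
  also have "minv D *\<^sub>v (minv C *\<^sub>v v\<^sub>1) = minv D * minv C *\<^sub>v v\<^sub>1"
    using assoc_mult_mat_vec[OF c(2,1) v(1)] by simp
  finally show ?thesis .
qed

text \<open>The new entries of \<open>D'\<^sup>-\<^sup>1 C'\<^sup>-\<^sup>1 b\<close> are the last entries of the solution of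
  \<open>four_block_mat A B\<^sup>T B G x = b\<close>.\<close>

lemma bcd_factors_step:
  assumes b: "b\<^sub>1 \<in> carrier_vec n" "b\<^sub>2 \<in> carrier_vec p" and b_nonneg: "0\<^sub>v (n + p) \<le> b\<^sub>1 @\<^sub>v b\<^sub>2"
    and pos: "\<And>x. 0\<^sub>v (n + p) \<le> x \<Longrightarrow> four_block_mat A B\<^sup>T B G *\<^sub>v x = b\<^sub>1 @\<^sub>v b\<^sub>2 \<Longrightarrow> 0\<^sub>v (n + p) \<lless> x"
  shows "bcd_factors (n + p) (four_block_mat A B\<^sup>T B G) (b\<^sub>1 @\<^sub>v b\<^sub>2) C' D'"
  unfolding bcd_factors_def
proof (intro conjI C'_inv(1) D'_inv(1) C'_D'_product)
  let ?K = "B * minv A"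
  have K: "0\<^sub>m p n \<le> - ?K"
  proof -
    have "0\<^sub>m p n \<le> - B * minv A"
      by (rule mult_mat_nonneg[OF _ A(2) B_nonpos monotone_mat_invertible(2)[OF mono]]) (use B in simp)
    then show ?thesis using A B by simp
  qed
  have Kc: "- ?K \<in> carrier_mat p n" using BA(1) by simp
  have Cc: "minv C - 1\<^sub>m n \<in> carrier_mat n n" by (simp add: minus_carrier_mat)
  have "minv C' - 1\<^sub>m (n + p) = four_block_mat (minv C - 1\<^sub>m n) (0\<^sub>m n p) (- ?K) (0\<^sub>m p p)"
    unfolding C'_inv(2) using CD(2) Kc by (intro eq_matI) auto
  also have "0\<^sub>m (n + p) (n + p) \<le> \<dots>"
    using Cc Kc K fac by (intro four_block_mat_nonneg) (auto simp: bcd_factors_def)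
  finally show "0\<^sub>m (n + p) (n + p) \<le> minv C' - 1\<^sub>m (n + p)" .
  show "0\<^sub>m (n + p) (n + p) \<le> minv D'"
    unfolding D'_inv(2) using CD(5) S_inv(1,3) fac
    by (intro four_block_mat_nonneg) (auto simp: bcd_factors_def)
  \<comment> \<open>The new entries solve the Schur system; \<open>?X\<close> completes them by back
    substitution to the solution of the full system. Monotonicity makes \<open>?X\<close>
    nonnegative, and only then does \<open>pos\<close> make it strictly positive.\<close>
  let ?x = "minv S *\<^sub>v (b\<^sub>2 - ?K *\<^sub>v b\<^sub>1)"
  let ?X = "(minv A *\<^sub>v (b\<^sub>1 - B\<^sup>T *\<^sub>v ?x)) @\<^sub>v ?x"
  have x: "?x \<in> carrier_vec p" using S_inv(1) BA(1) b by simp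
  have X: "?X \<in> carrier_vec (n + p)" using x A B b by auto
  have "S *\<^sub>v ?x = b\<^sub>2 - ?K *\<^sub>v b\<^sub>1"
    using minv_mult_vec(1)[OF monotone_mat_invertible(1)[OF S_monotone]] BA(1) b by simp
  then have "?K *\<^sub>v b\<^sub>1 + S *\<^sub>v ?x = b\<^sub>2" using BA(1) b by (auto intro!: eq_vecI)
  then have eq: "four_block_mat A B\<^sup>T B G *\<^sub>v ?X = b\<^sub>1 @\<^sub>v b\<^sub>2"
    using block_elimination[OF b(1) x] by simp
  then have "0\<^sub>v (n + p) \<le> ?X" using mono' X b_nonneg by (simp add: monotone_mat_def)
  then have "0\<^sub>v (n + p) \<lless> ?X" using pos eq by blast
  then have "0 < ?X $ (n + i)" if "i < p" for i using that by (simp add: pos_vec_iff)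
  moreover have "?X $ (n + i) = ?x $ i" if "i < p" for i
    using that carrier_vecD[OF x] A by (simp del: index_mult_mat_vec)
  ultimately have "0 < ?x $ i" if "i < p" for i using that by metis
  with x have x_pos: "0\<^sub>v p \<lless> ?x" by (simp add: pos_vec_iff del: index_mult_mat_vec)
  have "0\<^sub>v n \<lless> minv D * minv C *\<^sub>v b\<^sub>1" using fac by (simp add: bcd_factors_def)
  with x_pos show "0\<^sub>v (n + p) \<lless> minv D' * minv C' *\<^sub>v (b\<^sub>1 @\<^sub>v b\<^sub>2)"
    unfolding step_mult_vec[OF b] by (rule append_vec_pos[rotated])
qed

end

end

subsection \<open>Block Cholesky factors of grounded Z-matrices\<close>

lemma block_start_Suc: "k < length ns \<Longrightarrow> block_start ns (Suc k) = block_start ns k + ns ! k"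
  by (simp add: block_start_def take_Suc_conv_app_nth)

lemma block_start_length: "block_start ns (length ns) = sum_list ns"
  by (simp add: block_start_def)

lemma block_start_le: "block_start ns k \<le> sum_list ns"
proof -
  have "sum_list ns = sum_list (take k ns @ drop k ns)" by simp
  also have "\<dots> = block_start ns k + sum_list (drop k ns)" by (simp only: sum_list_append block_start_def)
  finally show ?thesis by simp
qed

lemma leading_carrier: "leading ns A k \<in> carrier_mat (block_start ns k) (block_start ns k)"
  by (simp add: leading_def subblock_def)

lemma leading_index:
  "i < block_start ns k \<Longrightarrow> j < block_start ns k \<Longrightarrow> leading ns A k $$ (i,j) = A $$ (i,j)"
  by (simp add: leading_def subblock_def)

lemma leading_length: "A \<in> carrier_mat (sum_list ns) (sum_list ns) \<Longrightarrow> leading ns A (length ns) = A"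
  by (rule eq_matI) (auto simp: leading_def subblock_def block_start_length)

lemma transpose_eqD:
  assumes "A\<^sup>T = A" "A \<in> carrier_mat n n" "i < n" "j < n"
  shows "A $$ (i,j) = A $$ (j,i)"
  using assms by (metis carrier_matD index_transpose_mat(1))

lemma leading_Suc:
  assumes A: "A \<in> carrier_mat (sum_list ns) (sum_list ns)" "A\<^sup>T = A" and k: "k < length ns"
  shows "leading ns A (Suc k) = four_block_mat (leading ns A k) (block_row ns A (Suc k))\<^sup>T
    (block_row ns A (Suc k)) (diag_block ns A (Suc k))"
proof -
  have le: "block_start ns k + ns ! k \<le> sum_list ns"
    using block_start_le[of ns "Suc k"] k by (simp add: block_start_Suc)
  show ?thesis
  proof (rule eq_matI)
    fix i j
    assume "i < dim_row (four_block_mat (leading ns A k) (block_row ns A (Suc k))\<^sup>T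
        (block_row ns A (Suc k)) (diag_block ns A (Suc k)))"
      and "j < dim_col (four_block_mat (leading ns A k) (block_row ns A (Suc k))\<^sup>T
        (block_row ns A (Suc k)) (diag_block ns A (Suc k)))"
    then have ij: "i < block_start ns k + ns ! k" "j < block_start ns k + ns ! k"
      by (simp_all add: leading_def subblock_def diag_block_def)
    then have "A $$ (i,j) = A $$ (j,i)" using transpose_eqD[OF A(2,1)] le by simp
    then show "leading ns A (Suc k) $$ (i,j) = four_block_mat (leading ns A k)
        (block_row ns A (Suc k))\<^sup>T (block_row ns A (Suc k)) (diag_block ns A (Suc k)) $$ (i,j)"
      using ij k by (simp add: leading_def subblock_def diag_block_def block_row_def block_start_Suc)
  qed (use k in \<open>simp_all add: leading_def subblock_def diag_block_def block_start_Suc\<close>)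
qed

text \<open>Row sums stay nonnegative in a leading block because the columns cut off carry
  nonpositive off-diagonal entries: cutting can only raise a row sum.\<close>

lemma leading_grounded:
  assumes Z: "Z_matrix (sum_list ns) A"
    and rs: "\<And>i. i < sum_list ns \<Longrightarrow> 0 \<le> (\<Sum>j<sum_list ns. A $$ (i,j))"
    and gr: "grounded (block_start ns k) A b"
  defines "N \<equiv> block_start ns k"
  shows "Z_matrix N (leading ns A k)" "grounded N (leading ns A k) (vec N (\<lambda>i. b $ i))"
    "monotone_mat N (leading ns A k)"
proof -
  have N: "N \<le> sum_list ns" unfolding N_def by (rule block_start_le)
  have idx: "leading ns A k $$ (i,j) = A $$ (i,j)" if "i < N" "j < N" for i j
    using that by (simp add: N_def leading_index)
  have rsum: "(\<Sum>j<N. leading ns A k $$ (i,j)) = (\<Sum>j<N. A $$ (i,j))" if "i < N" for i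
    using that idx by (intro sum.cong) auto
  show Z': "Z_matrix N (leading ns A k)"
    using Z N by (auto simp: Z_matrix_def idx) (simp add: N_def leading_carrier)
  show gr': "grounded N (leading ns A k) (vec N (\<lambda>i. b $ i))"
    unfolding grounded_def
  proof (intro allI impI)
    fix Q assume Q: "Q \<subseteq> {..<N}" "Q \<noteq> {}" and "\<forall>i\<in>Q. \<forall>j<N. leading ns A k $$ (i,j) \<noteq> 0 \<longrightarrow> j \<in> Q"
    then have "\<forall>i\<in>Q. \<forall>j<N. A $$ (i,j) \<noteq> 0 \<longrightarrow> j \<in> Q"
      using idx by (metis lessThan_iff subsetD)
    with gr Q obtain i where "i \<in> Q" "0 < (\<Sum>j<N. A $$ (i,j))" "0 < b $ i"
      unfolding grounded_def N_def by meson
    moreover from this(1) Q(1) have "i < N" by auto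
    ultimately show "\<exists>i\<in>Q. 0 < (\<Sum>j<N. leading ns A k $$ (i,j)) \<and> 0 < vec N (\<lambda>i. b $ i) $ i"
      using rsum by (intro bexI[of _ i]) auto
  qed
  show "monotone_mat N (leading ns A k)"
  proof (rule grounded_monotone_mat[OF Z' _ gr'])
    fix i assume i: "i < N"
    have "{..<sum_list ns} = {..<N} \<union> {N..<sum_list ns}" using N by auto
    then have "(\<Sum>j<sum_list ns. A $$ (i,j)) = (\<Sum>j<N. A $$ (i,j)) + (\<Sum>j\<in>{N..<sum_list ns}. A $$ (i,j))"
      by (simp add: sum.union_disjoint ivl_disj_int)
    moreover have "(\<Sum>j\<in>{N..<sum_list ns}. A $$ (i,j)) \<le> 0"
      using Z i N by (intro sum_nonpos) (auto simp: Z_matrix_def)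
    ultimately show "0 \<le> (\<Sum>j<N. leading ns A k $$ (i,j))"
      using rs[of i] i N rsum[OF i] by simp
  qed
qed

lemma invertible_dim_one: "invertible_dim n (1\<^sub>m n)" "minv (1\<^sub>m n) = 1\<^sub>m n"
  using invertible_dimI[of "1\<^sub>m n" n "1\<^sub>m n"] by simp_all

text \<open>Base case of the induction over blocks: for a single block \<open>K b\<close> is the
  solution \<open>A^-1 b\<close> itself.\<close>

lemma monotone_mat_bcd_factors:
  assumes mono: "monotone_mat n A" and b: "b \<in> carrier_vec n" "0\<^sub>v n \<le> b"
    and pos: "\<And>x. 0\<^sub>v n \<le> x \<Longrightarrow> A *\<^sub>v x = b \<Longrightarrow> 0\<^sub>v n \<lless> x"
  shows "bcd_factors n A b (1\<^sub>m n) A"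
proof -
  note inv = monotone_mat_invertible[OF mono]
  have c: "A \<in> carrier_mat n n" "minv A \<in> carrier_mat n n" using inv by (auto simp: invertible_dim_def)
  have "0\<^sub>v n \<le> minv A *\<^sub>v b" by (rule mult_mat_vec_nonneg[OF c(2) inv(2) b(2)])
  moreover have "A *\<^sub>v (minv A *\<^sub>v b) = b" by (rule minv_mult_vec(1)[OF inv(1) b(1)])
  ultimately have "0\<^sub>v n \<lless> minv A *\<^sub>v b" by (rule pos)
  moreover have "0\<^sub>m n n \<le> 1\<^sub>m n - (1\<^sub>m n :: real mat)"
    by (subst nonneg_mat_iff) (auto simp: minus_carrier_mat)
  ultimately show ?thesis
    using inv c by (simp add: bcd_factors_def invertible_dim_one)
qed

text \<open>Every leading block is monotone and has a strictly positive solution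
  (\<open>lead\<close>). Applied to two consecutive leading blocks, this supplies the hypotheses of
  \<open>schur_step\<close> and of \<open>bcd_factors_step\<close>. The shift to
  \<open>Suc k\<close> skips the placeholder of the recursion at 0.\<close>

lemma bcd_factors_upto:
  assumes Z: "Z_matrix (sum_list ns) A" and sym: "A\<^sup>T = A"
    and rs: "\<And>i. i < sum_list ns \<Longrightarrow> 0 \<le> (\<Sum>j<sum_list ns. A $$ (i,j))"
    and b: "b \<in> carrier_vec (sum_list ns)" "0\<^sub>v (sum_list ns) \<le> b"
    and gr: "\<And>k. k \<le> length ns \<Longrightarrow> grounded (block_start ns k) A b"
  shows "Suc k \<le> length ns \<Longrightarrow> bcd_factors (block_start ns (Suc k)) (leading ns A (Suc k))
    (vec (block_start ns (Suc k)) (\<lambda>i. b $ i)) (bcd_C_upto ns A (Suc k)) (bcd_D_upto ns A (Suc k))"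
proof (induction k)
  have A: "A \<in> carrier_mat (sum_list ns) (sum_list ns)" using Z by (simp add: Z_matrix_def)
  have b': "vec (block_start ns k) (\<lambda>i. b $ i) \<in> carrier_vec (block_start ns k)"
    "0\<^sub>v (block_start ns k) \<le> vec (block_start ns k) (\<lambda>i. b $ i)" for k
    using b block_start_le[of ns k] by (auto simp: nonneg_vec_iff)
  have lead: "monotone_mat (block_start ns k) (leading ns A k)"
    "\<And>x. 0\<^sub>v (block_start ns k) \<le> x \<Longrightarrow> leading ns A k *\<^sub>v x = vec (block_start ns k) (\<lambda>i. b $ i)
      \<Longrightarrow> 0\<^sub>v (block_start ns k) \<lless> x" if k: "k \<le> length ns" for k
  proof -
    note lg = leading_grounded[OF Z rs gr[OF k]]
    show "monotone_mat (block_start ns k) (leading ns A k)" by (rule lg(3))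
    show "0\<^sub>v (block_start ns k) \<lless> x"
      if "0\<^sub>v (block_start ns k) \<le> x" "leading ns A k *\<^sub>v x = vec (block_start ns k) (\<lambda>i. b $ i)" for x
      using grounded_solution_pos[OF lg(1,2) b'] that by (simp add: nonneg_vec_iff)
  qed
  {
    case 0
    then have "block_start ns (Suc 0) = ns ! 0" by (cases ns) (simp_all add: block_start_def)
    moreover have "leading ns A (Suc 0) = diag_block ns A (Suc 0)"
      using calculation by (simp add: leading_def diag_block_def) (simp add: block_start_def)
    moreover have "bcd_factors (block_start ns (Suc 0)) (leading ns A (Suc 0))
        (vec (block_start ns (Suc 0)) (\<lambda>i. b $ i)) (1\<^sub>m (block_start ns (Suc 0))) (leading ns A (Suc 0))"
      by (rule monotone_mat_bcd_factors[OF lead(1)[OF 0] b' lead(2)[OF 0]])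
    ultimately show ?case by (simp only: bcd_C_upto.simps bcd_D_upto.simps)
  next
    case (Suc k)
    let ?N = "block_start ns (Suc k)" and ?n = "ns ! Suc k"
    let ?B = "block_row ns A (Suc (Suc k))" and ?G = "diag_block ns A (Suc (Suc k))"
    have k: "Suc k < length ns" using Suc.prems by simp
    have N: "block_start ns (Suc (Suc k)) = ?N + ?n" by (rule block_start_Suc[OF k])
    have le: "?N + ?n \<le> sum_list ns" using block_start_le[of ns "Suc (Suc k)"] N by simp
    note split = leading_Suc[OF A sym k]
    have lsym: "(leading ns A (Suc k))\<^sup>T = leading ns A (Suc k)"
      using leading_carrier[of ns A "Suc k"] transpose_eqD[OF sym A] le
      by (intro eq_matI) (auto simp: leading_index)
    have Bc: "?B \<in> carrier_mat ?n ?N" by (simp add: block_row_def subblock_def)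
    have "- ?B \<in> carrier_mat ?n ?N" using Bc by simp
    moreover have "0 \<le> (- ?B) $$ (i,j)" if "i < ?n" "j < ?N" for i j
      using Z that le by (simp add: block_row_def subblock_def Z_matrix_def)
    ultimately have Bn: "0\<^sub>m ?n ?N \<le> - ?B" by (simp add: nonneg_mat_iff)
    have Gc: "?G \<in> carrier_mat ?n ?n" by (simp add: diag_block_def subblock_def)
    interpret schur_step ?N ?n "leading ns A (Suc k)" ?B ?G
      by (unfold_locales; (fold split N)?)
        (use lead(1) k lsym Bc Bn Gc Suc.prems in simp_all)
    have b_split: "vec (?N + ?n) (\<lambda>i. b $ i) = vec ?N (\<lambda>i. b $ i) @\<^sub>v vec ?n (\<lambda>i. b $ (?N + i))"
      by (rule eq_vecI) auto
    have "bcd_factors (?N + ?n) (leading ns A (Suc (Suc k))) (vec (?N + ?n) (\<lambda>i. b $ i))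
       (four_block_mat (bcd_C_upto ns A (Suc k)) (0\<^sub>m ?N ?n)
          (?B * minv (leading ns A (Suc k)) * bcd_C_upto ns A (Suc k)) (1\<^sub>m ?n))
       (four_block_mat (bcd_D_upto ns A (Suc k)) (0\<^sub>m ?N ?n) (0\<^sub>m ?n ?N)
          (?G - ?B * minv (leading ns A (Suc k)) * ?B\<^sup>T))"
      unfolding split b_split
    proof (rule bcd_factors_step[OF Suc.IH])
      show "Suc k \<le> length ns" using k by simp
      show "0\<^sub>v (?N + ?n) \<le> vec ?N (\<lambda>i. b $ i) @\<^sub>v vec ?n (\<lambda>i. b $ (?N + i))"
        using b'(2)[of "Suc (Suc k)"] unfolding N b_split .
      show "0\<^sub>v (?N + ?n) \<lless> x" if "0\<^sub>v (?N + ?n) \<le> x"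
        "four_block_mat (leading ns A (Suc k)) ?B\<^sup>T ?B ?G *\<^sub>v x =
          vec ?N (\<lambda>i. b $ i) @\<^sub>v vec ?n (\<lambda>i. b $ (?N + i))" for x
        using lead(2)[OF Suc.prems, of x] that unfolding N split b_split by simp
    qed simp_all
    then show ?case unfolding N by (simp add: Let_def)
  }
qed

lemma bcd_factors_bcd:
  assumes "Z_matrix (sum_list ns) A" "A\<^sup>T = A" "ns \<noteq> []"
    and "\<And>i. i < sum_list ns \<Longrightarrow> 0 \<le> (\<Sum>j<sum_list ns. A $$ (i,j))"
    and b: "b \<in> carrier_vec (sum_list ns)" "0\<^sub>v (sum_list ns) \<le> b"
    and "\<And>k. k \<le> length ns \<Longrightarrow> grounded (block_start ns k) A b"
  shows "bcd_factors (sum_list ns) A b (bcd_C ns A) (bcd_D ns A)"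
proof -
  obtain k where k: "length ns = Suc k" using assms(3) by (cases ns) auto
  have "vec (sum_list ns) (\<lambda>i. b $ i) = b" using b(1) by (intro eq_vecI) auto
  moreover have "A \<in> carrier_mat (sum_list ns) (sum_list ns)" using assms(1) by (simp add: Z_matrix_def)
  ultimately show ?thesis
    using bcd_factors_upto[OF assms(1,2,4-7), of k] leading_length[of A ns] block_start_length[of ns]
    by (simp add: bcd_C_def bcd_D_def k)
qed

text \<open>Stage \<open>k\<close> of the recursion reads only entries within the first
  \<open>k\<close> blocks, so a further block at the end leaves the earlier stages
  unchanged.\<close>

lemma bcd_upto_append:
  assumes A: "\<And>i j. i < sum_list ns \<Longrightarrow> j < sum_list ns \<Longrightarrow> A' $$ (i,j) = A $$ (i,j)"
    and k: "k \<le> length ns"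
  shows "bcd_C_upto (ns @ [p]) A' k = bcd_C_upto ns A k" "bcd_D_upto (ns @ [p]) A' k = bcd_D_upto ns A k"
proof -
  have bs: "block_start (ns @ [p]) i = block_start ns i" if "i \<le> length ns" for i
    using that by (simp add: block_start_def)
  have lead: "leading (ns @ [p]) A' i = leading ns A i" if "i \<le> length ns" for i
    using bs[OF that] block_start_le[of ns i] A by (auto simp: leading_def subblock_def intro!: cong_mat)
  have le: "block_start ns i + ns ! i \<le> sum_list ns" if "i < length ns" for i
    using block_start_le[of ns "Suc i"] block_start_Suc[OF that] by simp
  have row: "block_row (ns @ [p]) A' (Suc i) = block_row ns A (Suc i)" if "i < length ns" for i
    using bs[of i] le[OF that] A that by (auto simp: block_row_def subblock_def nth_append intro!: cong_mat)
  have dia: "diag_block (ns @ [p]) A' (Suc i) = diag_block ns A (Suc i)" if "i < length ns" for i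
    using bs[of i] le[OF that] A that by (auto simp: diag_block_def subblock_def nth_append intro!: cong_mat)
  have "bcd_C_upto (ns @ [p]) A' k = bcd_C_upto ns A k \<and> bcd_D_upto (ns @ [p]) A' k = bcd_D_upto ns A k"
    using k
  proof (induction k)
    case (Suc k)
    then have "k < length ns" by simp
    with Suc.IH show ?case
      by (cases k) (simp_all add: nth_append row dia lead bs Let_def length_greater_0_conv[symmetric] del: length_greater_0_conv)
  qed simp
  then show "bcd_C_upto (ns @ [p]) A' k = bcd_C_upto ns A k"
    "bcd_D_upto (ns @ [p]) A' k = bcd_D_upto ns A k" by simp_all
qed

text \<open>Identifies the factors of the interconnection with the bordered factors of
  \<open>schur_step\<close>, built on the factors of the old grid.\<close>

lemma bcd_snoc:
  assumes "A \<in> carrier_mat (sum_list ns) (sum_list ns)" "ns \<noteq> []"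
    and "B \<in> carrier_mat p (sum_list ns)" "G \<in> carrier_mat p p"
  defines "A' \<equiv> four_block_mat A B\<^sup>T B G"
  shows "bcd_C (ns @ [p]) A' = four_block_mat (bcd_C ns A) (0\<^sub>m (sum_list ns) p)
      (B * minv A * bcd_C ns A) (1\<^sub>m p)"
    "bcd_D (ns @ [p]) A' = four_block_mat (bcd_D ns A) (0\<^sub>m (sum_list ns) p)
      (0\<^sub>m p (sum_list ns)) (G - B * minv A * B\<^sup>T)"
proof -
  obtain k where k: "length ns = Suc k" using assms(2) by (cases ns) auto
  have A': "A' $$ (i,j) = A $$ (i,j)" if "i < sum_list ns" "j < sum_list ns" for i j
    using assms(1,4) that by (simp add: A'_def)
  note app = bcd_upto_append[where ns = ns and A = A and A' = A' and p = p and k = "length ns", OF A' le_refl]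
  have bs: "block_start (ns @ [p]) (length ns) = sum_list ns" by (simp add: block_start_def)
  have "leading (ns @ [p]) A' (length ns) = A"
    using assms(1,4) by (intro eq_matI) (auto simp: leading_def subblock_def bs A'_def)
  moreover have "block_row (ns @ [p]) A' (Suc (length ns)) = B"
    using assms(1,3,4) by (intro eq_matI) (auto simp: block_row_def subblock_def bs A'_def)
  moreover have "diag_block (ns @ [p]) A' (Suc (length ns)) = G"
    using assms(1,3,4) by (intro eq_matI) (auto simp: diag_block_def subblock_def bs A'_def)
  ultimately show "bcd_C (ns @ [p]) A' = four_block_mat (bcd_C ns A) (0\<^sub>m (sum_list ns) p)
      (B * minv A * bcd_C ns A) (1\<^sub>m p)"
    "bcd_D (ns @ [p]) A' = four_block_mat (bcd_D ns A) (0\<^sub>m (sum_list ns) p)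
      (0\<^sub>m p (sum_list ns)) (G - B * minv A * B\<^sup>T)"
    using app bs by (simp_all add: bcd_C_def bcd_D_def k Let_def nth_append)
qed

subsection \<open>Feasibility\<close>

lemma diag_mult_vec:
  assumes "d \<in> carrier_vec n" "x \<in> carrier_vec n"
  shows "diag d *\<^sub>v x = vec n (\<lambda>i. d $ i * x $ i)"
proof (rule eq_vecI)
  fix i assume "i < dim_vec (vec n (\<lambda>i. d $ i * x $ i))"
  then have i: "i < n" by simp
  have D: "diag d \<in> carrier_mat n n" using assms(1) by (auto simp: diag_def)
  have "(diag d *\<^sub>v x) $ i = (\<Sum>j<n. if j = i then d $ i * x $ i else 0)"
    unfolding mult_mat_vec_index[OF D assms(2) i]
    using i assms(1) by (intro sum.cong) (auto simp: diag_def mat_diag_def)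
  then show "(diag d *\<^sub>v x) $ i = vec n (\<lambda>i. d $ i * x $ i) $ i" using i by simp
qed (use assms in \<open>simp add: diag_def mat_diag_def\<close>)

lemma minv_diag:
  assumes "0\<^sub>v n \<lless> u"
  shows "minv (diag u) = diag (vec n (\<lambda>i. 1 / u $ i))"
proof -
  have "u \<in> carrier_vec n" and pos: "\<And>i. i < n \<Longrightarrow> 0 < u $ i" using assms by (auto simp: pos_vec_iff)
  then have "diag u = mat_diag n (\<lambda>i. u $ i)" by (auto simp: diag_def)
  moreover have "diag (vec n (\<lambda>i. 1 / u $ i)) = mat_diag n (\<lambda>i. 1 / u $ i)"
    by (auto simp: diag_def mat_diag_def)
  moreover have "mat_diag n (\<lambda>i. u $ i) * mat_diag n (\<lambda>i. 1 / u $ i) = 1\<^sub>m n"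
    unfolding mat_diag_diag using pos by (intro eq_matI) (auto simp: mat_diag_def less_imp_neq[symmetric])
  ultimately show ?thesis using minv_unique[of "diag u" n "diag (vec n (\<lambda>i. 1 / u $ i))"] by simp
qed

lemma minv_diag_mult_vec:
  assumes "0\<^sub>v n \<lless> u" "c \<in> carrier_vec n"
  shows "minv (diag u) *\<^sub>v c = vec n (\<lambda>i. c $ i / u $ i)"
  unfolding minv_diag[OF assms(1)] using diag_mult_vec[OF _ assms(2), of "vec n (\<lambda>i. 1 / u $ i)"]
  by (auto intro: eq_vecI)

lemma minv_diag_carrier:
  assumes "0\<^sub>v n \<lless> u"
  shows "minv (diag u) \<in> carrier_mat n n"
  unfolding minv_diag[OF assms] by (simp add: diag_def)

text \<open>\<open>C\<^sup>T\<close> cancels the leftmost factor of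
  \<open>A^-1 = C^-T (D^-1 C^-1)\<close>. This trades the voltages transformed by
  \<open>C\<^sup>T\<close> for \<open>K b\<close>, where signs are visible.\<close>

lemma bcd_factors_solution:
  assumes fac: "bcd_factors n A b C D" and b: "b \<in> carrier_vec n"
  shows "C\<^sup>T *\<^sub>v (minv A *\<^sub>v b) = minv D * minv C *\<^sub>v b" "minv A \<in> carrier_mat n n"
proof -
  have iC: "invertible_dim n C" and iD: "invertible_dim n D" and A: "C * D * C\<^sup>T = A"
    using fac by (auto simp: bcd_factors_def)
  note iCT = invertible_dim_transpose[OF iC]
  note c = carrier_invertible_dim[OF iC] carrier_invertible_dim[OF iD] carrier_invertible_dim[OF iCT(1)]
  have eq: "minv A = minv C\<^sup>T * (minv D * minv C)"
    unfolding A[symmetric] minv_mult(2)[OF minv_mult(1)[OF iC iD] iCT(1)] minv_mult(2)[OF iC iD] ..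
  then show "minv A \<in> carrier_mat n n" using c by simp
  have "minv A *\<^sub>v b = minv C\<^sup>T *\<^sub>v (minv D * minv C *\<^sub>v b)"
    unfolding eq using c b by (intro assoc_mult_mat_vec[of _ n n _ n]) auto
  then show "C\<^sup>T *\<^sub>v (minv A *\<^sub>v b) = minv D * minv C *\<^sub>v b"
    using minv_mult_vec(1)[OF iCT(1), of "minv D * minv C *\<^sub>v b"] c b by simp
qed

text \<open>With \<open>u = D\<^sup>-\<^sup>1 C\<^sup>-\<^sup>1 b\<close> and \<open>z = D\<^sup>-\<^sup>1 C\<^sup>-\<^sup>1 [u]\<^sup>-\<^sup>1 c < u / 4\<close>, the vector \<open>y\<close> with
  \<open>C\<^sup>T y = u - 2 z\<close> satisfies \<open>A y = b - 2 [u]\<^sup>-\<^sup>1 c\<close>, and \<open>y \<ge> u - 2 z > u / 2\<close> as \<open>C\<^sup>-\<^sup>1 \<ge> I\<close>.\<close>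

lemma bcd_factors_subsolution:
  assumes fac: "bcd_factors n A b C D" and b: "b \<in> carrier_vec n" and c: "0\<^sub>v n \<lless> c"
    and cond: "minv D * minv C * minv (diag (minv D * minv C *\<^sub>v b)) *\<^sub>v c
      \<lless> (1/4) \<cdot>\<^sub>v (minv D * minv C *\<^sub>v b)"
  shows "\<exists>y. 0\<^sub>v n \<lless> y \<and> (\<forall>i<n. (A *\<^sub>v y) $ i + c $ i / y $ i \<le> b $ i)"
proof -
  let ?K = "minv D * minv C"
  have iC: "invertible_dim n C" and iD: "invertible_dim n D" and A: "C * D * C\<^sup>T = A"
    and C_ge: "0\<^sub>m n n \<le> minv C - 1\<^sub>m n" and u_pos: "0\<^sub>v n \<lless> ?K *\<^sub>v b"
    using fac by (auto simp: bcd_factors_def)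
  note iCT = invertible_dim_transpose[OF iC]
  note cC = carrier_invertible_dim[OF iC] and cD = carrier_invertible_dim[OF iD]
    and cT = carrier_invertible_dim[OF iCT(1)]
  have K: "?K \<in> carrier_mat n n" using cC cD by simp
  have cc: "c \<in> carrier_vec n" and c_pos: "\<And>i. i < n \<Longrightarrow> 0 < c $ i" using c by (auto simp: pos_vec_iff)
  define u where "u = ?K *\<^sub>v b"
  have u: "u \<in> carrier_vec n" and up: "\<And>i. i < n \<Longrightarrow> 0 < u $ i"
    using u_pos unfolding u_def[symmetric] by (auto simp: pos_vec_iff)
  define q where "q = vec n (\<lambda>i. c $ i / u $ i)"
  define z where "z = ?K *\<^sub>v q"
  have q: "q \<in> carrier_vec n" by (simp add: q_def)
  have z: "z \<in> carrier_vec n" unfolding z_def by (rule mult_mat_vec_carrier[OF K q])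
  have "?K * minv (diag u) *\<^sub>v c = z"
    unfolding z_def q_def
    using assoc_mult_mat_vec[OF K minv_diag_carrier[OF u_pos] cc] minv_diag_mult_vec[OF u_pos cc]
    by (simp add: u_def)
  then have z_lt: "z $ i < u $ i / 4" if "i < n" for i
    using cond that u unfolding u_def[symmetric] vec_less_def by simp
  define s where "s = u - 2 \<cdot>\<^sub>v z"
  have s: "s \<in> carrier_vec n" using u z by (simp add: s_def)
  have s_gt: "u $ i / 2 < s $ i" if "i < n" for i
    using z_lt[OF that] u z that by (simp add: s_def)
  define y where "y = (minv C)\<^sup>T *\<^sub>v s"
  have y: "y \<in> carrier_vec n" using cC(2) s by (simp add: y_def)
  have y_ge: "s $ i \<le> y $ i" if i: "i < n" for i
  proof -
    have Ec: "minv C - 1\<^sub>m n \<in> carrier_mat n n" by (simp add: minus_carrier_mat)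
    then have E: "(minv C - 1\<^sub>m n)\<^sup>T \<in> carrier_mat n n" by (rule transpose_carrier_mat[THEN iffD2])
    have "0\<^sub>m n n \<le> (minv C - 1\<^sub>m n)\<^sup>T"
      unfolding nonneg_mat_iff[OF E] using C_ge[unfolded nonneg_mat_iff[OF Ec]] Ec by simp
    moreover have "0\<^sub>v n \<le> s"
      using s s_gt up by (force simp: nonneg_vec_iff)
    ultimately have "0\<^sub>v n \<le> (minv C - 1\<^sub>m n)\<^sup>T *\<^sub>v s" by (rule mult_mat_vec_nonneg[OF E])
    then have "0 \<le> ((minv C - 1\<^sub>m n)\<^sup>T *\<^sub>v s) $ i"
      using i unfolding nonneg_vec_iff by blast
    also have "(minv C - 1\<^sub>m n)\<^sup>T = (minv C)\<^sup>T - 1\<^sub>m n"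
      using cC(2) by (intro eq_matI) auto
    also have "((minv C)\<^sup>T - 1\<^sub>m n) *\<^sub>v s = y - s"
      unfolding y_def using minus_mult_distrib_mat_vec[of "(minv C)\<^sup>T" n n "1\<^sub>m n" s] cC(2) s by simp
    finally show ?thesis using i s y by simp
  qed
  have CDK: "C * D *\<^sub>v (?K *\<^sub>v v) = v" if v: "v \<in> carrier_vec n" for v
    using minv_mult_vec(1)[OF minv_mult(1)[OF iC iD] v] by (simp add: minv_mult(2)[OF iC iD])
  have Ay: "A *\<^sub>v y = b - 2 \<cdot>\<^sub>v q"
  proof -
    have "C\<^sup>T *\<^sub>v y = s" using minv_mult_vec(1)[OF iCT(1) s] by (simp add: y_def iCT(2))
    moreover have "A *\<^sub>v y = C * D *\<^sub>v (C\<^sup>T *\<^sub>v y)"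
      unfolding A[symmetric] using cC cD cT y by (intro assoc_mult_mat_vec[of _ n n _ n]) auto
    moreover have CD: "C * D \<in> carrier_mat n n" using cC cD by simp
    moreover have "C * D *\<^sub>v (2 \<cdot>\<^sub>v z) = 2 \<cdot>\<^sub>v (C * D *\<^sub>v z)"
      by (rule mult_mat_vec[OF CD z])
    ultimately show ?thesis
      using mult_minus_distrib_mat_vec[OF CD u, of "2 \<cdot>\<^sub>v z"] z CDK[OF b] CDK[OF q]
      by (simp add: s_def u_def z_def)
  qed
  have "(A *\<^sub>v y) $ i + c $ i / y $ i \<le> b $ i" if i: "i < n" for i
  proof -
    have "u $ i / 2 \<le> y $ i" using s_gt[OF i] y_ge[OF i] by simp
    then have "c $ i / y $ i \<le> c $ i / (u $ i / 2)"
      using up[OF i] c_pos[OF i] by (intro divide_left_mono) auto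
    moreover have "(A *\<^sub>v y) $ i = b $ i - 2 * (c $ i / u $ i)"
      unfolding Ay using i b by (simp add: q_def)
    ultimately show ?thesis by (simp add: mult.commute)
  qed
  moreover have "0\<^sub>v n \<lless> y"
    using y y_ge s_gt up by (force simp: pos_vec_iff)
  ultimately show ?thesis by blast
qed

text \<open>Knaster--Tarski for the monotone map \<open>x \<mapsto> A\<^sup>-\<^sup>1 (b - [x]\<^sup>-\<^sup>1 c)\<close> on \<open>x \<ge> y\<close>, which is bounded
  by \<open>A\<^sup>-\<^sup>1 b\<close>.\<close>

lemma monotone_mat_solution:
  assumes mono: "monotone_mat n A" and b: "b \<in> carrier_vec n" and c: "0\<^sub>v n \<lless> c"
    and y: "0\<^sub>v n \<lless> y" and sub: "\<And>i. i < n \<Longrightarrow> (A *\<^sub>v y) $ i + c $ i / y $ i \<le> b $ i"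
  shows "\<exists>x. 0\<^sub>v n \<lless> x \<and> (\<forall>i<n. (A *\<^sub>v x) $ i + c $ i / x $ i = b $ i)"
proof -
  note inv = monotone_mat_invertible[OF mono]
  note M = carrier_invertible_dim(2)[OF inv(1)] and A = carrier_invertible_dim(1)[OF inv(1)]
  have yc: "y \<in> carrier_vec n" and yp: "\<And>i. i < n \<Longrightarrow> 0 < y $ i" using y by (auto simp: pos_vec_iff)
  have cp: "\<And>i. i < n \<Longrightarrow> 0 < c $ i" using c by (auto simp: pos_vec_iff)
  define r where "r = (\<lambda>x. vec n (\<lambda>i. b $ i - c $ i / x $ i))"
  define T where "T = (\<lambda>x. minv A *\<^sub>v r x)"
  have r: "r x \<in> carrier_vec n" for x by (simp add: r_def)
  have T: "T x \<in> carrier_vec n" for x unfolding T_def by (rule mult_mat_vec_carrier[OF M r])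
  \<comment> \<open>Staying above the positive vector \<open>y\<close> keeps all entries positive,
    where \<open>c / x\<close> is decreasing in \<open>x\<close>; monotonicity of \<open>T\<close>
    would fail across 0.\<close>
  have T_mono: "T x \<le> T x'" if "y \<le> x" "x \<le> x'" "x' \<in> carrier_vec n" for x x'
  proof -
    have "r x \<le> r x'"
      unfolding less_eq_vec_def
    proof (intro conjI allI impI)
      fix i assume "i < dim_vec (r x')"
      then have i: "i < n" by (simp add: r_def)
      then have "y $ i \<le> x $ i" "x $ i \<le> x' $ i" using that by (auto simp: less_eq_vec_def)
      then show "r x $ i \<le> r x' $ i"
        using i yp[OF i] cp[OF i] by (auto simp: r_def intro!: divide_left_mono)
    qed (simp add: r_def)
    then show ?thesis unfolding T_def by (rule mult_mat_vec_mono[OF M inv(2) r r])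
  qed
  have T_bound: "T x \<le> minv A *\<^sub>v b" if "y \<le> x" "x \<in> carrier_vec n" for x
  proof -
    have "r x \<le> b"
      unfolding less_eq_vec_def
    proof (intro conjI allI impI)
      fix i assume "i < dim_vec b"
      then have i: "i < n" using b by simp
      then have "0 < x $ i" using that yp[OF i] by (force simp: less_eq_vec_def)
      then show "r x $ i \<le> b $ i" using i cp[OF i] by (simp add: r_def)
    qed (use b in \<open>simp add: r_def\<close>)
    then show ?thesis unfolding T_def by (rule mult_mat_vec_mono[OF M inv(2) r b])
  qed
  \<comment> \<open>The supremum of the post-fixed points is taken entry by entry. It exists since
    \<open>X\<close> contains \<open>y\<close> (the subsolution property multiplied by the
    nonnegative \<open>minv A\<close>) and is bounded by \<open>minv A *\<^sub>v b\<close>.\<close>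
  define X where "X = {x \<in> carrier_vec n. y \<le> x \<and> x \<le> T x}"
  have "A *\<^sub>v y \<le> r y"
    unfolding less_eq_vec_def using sub A by (force simp: r_def simp del: index_mult_mat_vec)
  then have "minv A *\<^sub>v (A *\<^sub>v y) \<le> T y"
    unfolding T_def by (intro mult_mat_vec_mono[OF M inv(2) _ r]) (use A yc in auto)
  then have yX: "y \<in> X" using yc minv_mult_vec(2)[OF inv(1) yc] by (simp add: X_def)
  have X_bound: "x $ i \<le> (minv A *\<^sub>v b) $ i" if "x \<in> X" "i < n" for x i
  proof -
    have "x \<le> minv A *\<^sub>v b" using that T_bound[of x] order.trans[of x "T x"] by (auto simp: X_def)
    then show ?thesis using that M by (auto simp: less_eq_vec_def simp del: index_mult_mat_vec)
  qed
  then have bdd: "bdd_above ((\<lambda>x. x $ i) ` X)" if "i < n" for i using that by (auto intro!: bdd_aboveI2)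
  define m where "m = vec n (\<lambda>i. SUP x\<in>X. x $ i)"
  have mc: "m \<in> carrier_vec n" by (simp add: m_def)
  have X_le: "x \<le> m" if x: "x \<in> X" for x
    unfolding less_eq_vec_def
  proof (intro conjI allI impI)
    show "dim_vec x = dim_vec m" using x by (simp add: X_def m_def)
    fix i assume "i < dim_vec m"
    then have i: "i < n" by (simp add: m_def)
    then show "x $ i \<le> m $ i" using cSUP_upper[OF x bdd[OF i]] by (simp add: m_def)
  qed
  have "y \<le> m" by (rule X_le[OF yX])
  have "m \<le> T m"
    unfolding less_eq_vec_def
  proof (intro conjI allI impI)
    show "dim_vec m = dim_vec (T m)" using T[of m] by (simp add: m_def)
    fix i assume "i < dim_vec (T m)"
    then have i: "i < n" using T[of m] by simp
    have "x $ i \<le> T m $ i" if x: "x \<in> X" for x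
    proof -
      have "x \<le> T x" "T x \<le> T m" using x T_mono[OF _ X_le[OF x] mc] by (auto simp: X_def)
      then have "x \<le> T m" by (rule order.trans)
      then show ?thesis using i T[of m] by (auto simp: less_eq_vec_def)
    qed
    then have "(SUP x\<in>X. x $ i) \<le> T m $ i" using yX by (intro cSUP_least) auto
    then show "m $ i \<le> T m $ i" using i by (simp add: m_def)
  qed
  \<comment> \<open>\<open>m <= T m\<close> implies \<open>T m <= T (T m)\<close>, so
    \<open>T m\<close> lies in \<open>X\<close> and therefore below its supremum
    \<open>m\<close>.\<close>
  moreover from this have "y \<le> T m" using \<open>y \<le> m\<close> by (rule order.trans[rotated])
  then have "T m \<in> X"
    using T_mono[OF \<open>y \<le> m\<close> \<open>m \<le> T m\<close> T] T by (simp add: X_def)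
  then have "T m \<le> m" by (rule X_le)
  ultimately have "T m = m" by (intro antisym)
  then have Am: "A *\<^sub>v m = r m" using minv_mult_vec(1)[OF inv(1) r, of m] by (simp add: T_def)
  have "(A *\<^sub>v m) $ i + c $ i / m $ i = b $ i" if "i < n" for i
    unfolding Am using that by (simp add: r_def)
  moreover have "0 < m $ i" if "i < n" for i
    using \<open>y \<le> m\<close> yp[OF that] that mc by (force simp: less_eq_vec_def)
  ultimately show ?thesis using mc by (intro exI[of _ m]) (simp add: pos_vec_iff)
qed

text \<open>For \<open>x > 0\<close>, dividing entry \<open>i\<close> of the power flow equation by
  \<open>x $ i\<close> turns it into \<open>A x + [x]^-1 c = b\<close>, so a positive subsolution
  suffices.\<close>

lemma feasibleI:
  assumes mono: "monotone_mat n A" and b: "0\<^sub>v n \<le> b" and c: "0\<^sub>v n \<lless> c"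
    and y: "0\<^sub>v n \<lless> y" "\<And>i. i < n \<Longrightarrow> (A *\<^sub>v y) $ i + c $ i / y $ i \<le> b $ i"
  shows "feasible A b c"
proof -
  have A: "A \<in> carrier_mat n n" using mono by (simp add: monotone_mat_def)
  have bc: "b \<in> carrier_vec n" and cc: "c \<in> carrier_vec n"
    using b c by (simp_all add: nonneg_vec_iff pos_vec_iff)
  obtain x where x: "0\<^sub>v n \<lless> x" and eq: "\<And>i. i < n \<Longrightarrow> (A *\<^sub>v x) $ i + c $ i / x $ i = b $ i"
    using monotone_mat_solution[OF mono bc c y] by blast
  have xc: "x \<in> carrier_vec n" and xp: "\<And>i. i < n \<Longrightarrow> 0 < x $ i" using x by (auto simp: pos_vec_iff)
  have "diag x * A *\<^sub>v x = diag x *\<^sub>v (A *\<^sub>v x)"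
    using A xc by (intro assoc_mult_mat_vec[of _ n n _ n]) (auto simp: diag_def)
  also have "\<dots> = vec n (\<lambda>i. x $ i * (A *\<^sub>v x) $ i)"
    by (rule diag_mult_vec[OF xc mult_mat_vec_carrier[OF A xc]])
  finally have prod: "diag x * A *\<^sub>v x = vec n (\<lambda>i. x $ i * (A *\<^sub>v x) $ i)" .
  have "x $ i * (A *\<^sub>v x) $ i - b $ i * x $ i + c $ i = 0" if "i < n" for i
    using xp[OF that] eq[OF that] by (simp add: field_simps del: index_mult_mat_vec)
  then have "diag x * A *\<^sub>v x - diag b *\<^sub>v x + c = 0\<^sub>v n"
    unfolding diag_mult_vec[OF bc xc] prod
    using cc by (intro eq_vecI) (simp_all del: index_mult_mat_vec)
  then show ?thesis using A b c bc cc x xc by (auto simp: feasible_def)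
qed

subsection \<open>Laplacians of grids\<close>

lemma laplacian_offdiag:
  assumes "weighted_graph V E w" "u \<noteq> v"
  shows "laplacian V E w u v \<le> 0" "{u, v} \<in> E \<Longrightarrow> laplacian V E w u v < 0"
  using assms by (auto simp: laplacian_def weighted_graph_def less_imp_le)

lemma laplacian_commute: "laplacian V E w u v = laplacian V E w v u"
  by (cases "u = v") (auto simp: laplacian_def insert_commute)

lemma laplacian_row_sum:
  assumes "finite V" "u \<in> V"
  shows "(\<Sum>v\<in>V. laplacian V E w u v) = 0"
proof -
  have "(\<Sum>v\<in>V - {u}. laplacian V E w u v) = (\<Sum>v\<in>V - {u}. if {u, v} \<in> E then - w {u, v} else 0)"
    by (intro sum.cong) (auto simp: laplacian_def)
  moreover have "laplacian V E w u u = - (\<Sum>v\<in>V - {u}. if {u, v} \<in> E then - w {u, v} else 0)"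
    by (simp add: laplacian_def)
  ultimately show ?thesis using assms by (simp add: sum.remove)
qed

lemma sum_nth_distinct:
  "distinct xs \<Longrightarrow> (\<Sum>j<length xs. f (xs ! j)) = (\<Sum>x\<in>set xs. f x :: 'a :: comm_monoid_add)"
  by (simp add: sum_list_distinct_conv_sum_set[symmetric] sum_list_sum_nth lessThan_atLeast0)

lemma node_mat_carrier: "node_mat Y us vs \<in> carrier_mat (length us) (length vs)"
  by (simp add: node_mat_def)

lemma node_mat_index:
  "i < length us \<Longrightarrow> j < length vs \<Longrightarrow> node_mat Y us vs $$ (i,j) = Y (us ! i) (vs ! j)"
  by (simp add: node_mat_def)

text \<open>Translates the index bound of a leading block into membership in the first
  \<open>k\<close> microgrids, the language of the path condition.\<close>

lemma take_loads: "take (block_start (load_block_sizes Ms) k) (loads Ms) = loads (take k Ms)"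
proof -
  have "loads Ms = loads (take k Ms @ drop k Ms)" by simp
  also have "\<dots> = loads (take k Ms) @ loads (drop k Ms)" unfolding loads_def by (simp only: map_append concat_append)
  finally have "loads Ms = loads (take k Ms) @ loads (drop k Ms)" .
  moreover have "block_start (load_block_sizes Ms) k = length (loads (take k Ms))"
    by (simp add: block_start_def load_block_sizes_def loads_def length_concat take_map comp_def)
  ultimately show ?thesis by simp
qed

lemma sum_list_load_block_sizes: "sum_list (load_block_sizes Ms) = length (loads Ms)"
  by (simp add: load_block_sizes_def loads_def length_concat comp_def)

text \<open>\<open>F\<close> is an arbitrary nonnegative diagonal shunt, so that one development
  covers three matrices: the old grid with \<open>E_L1\<close>, the interconnection with its virtual
  shunts, and the interconnection without extra shunts, whose feasibility is claimed.\<close>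

locale grid =
  fixes Ms :: "'v microgrid list" and V :: "'v set" and E :: "'v set set" and w :: "'v set \<Rightarrow> real"
    and F :: "real mat" and V_S :: "real vec"
  assumes Ms: "Ms \<noteq> []" "distinct (loads Ms @ sources Ms)" "V = set (loads Ms) \<union> set (sources Ms)"
    and graph: "weighted_graph V E w" and dpc: "descending_path_condition Ms E"
    and F: "F \<in> carrier_mat (length (loads Ms)) (length (loads Ms))" "diagonal_mat F"
      "0\<^sub>m (length (loads Ms)) (length (loads Ms)) \<le> F"
    and V_S: "0\<^sub>v (length (sources Ms)) \<lless> V_S"
begin

abbreviation "n \<equiv> length (loads Ms)"
abbreviation "Y \<equiv> laplacian V E w"
abbreviation "A \<equiv> node_mat Y (loads Ms) (loads Ms) + F"
abbreviation "b \<equiv> - (node_mat Y (loads Ms) (sources Ms) *\<^sub>v V_S)"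

lemma A_carrier: "A \<in> carrier_mat n n"
  using F(1) node_mat_carrier by simp

lemma A_index: "i < n \<Longrightarrow> j < n \<Longrightarrow> A $$ (i,j) = Y (loads Ms ! i) (loads Ms ! j) + F $$ (i,j)"
  using F(1) by (simp add: node_mat_index)

lemma A_offdiag:
  assumes "i < n" "j < n" "i \<noteq> j"
  shows "A $$ (i,j) = Y (loads Ms ! i) (loads Ms ! j)" "loads Ms ! i \<noteq> loads Ms ! j"
  using assms F Ms(2) by (auto simp: node_mat_index diagonal_mat_def nth_eq_iff_index_eq)

lemma A_Z_matrix: "Z_matrix n A"
  using A_carrier A_offdiag laplacian_offdiag(1)[OF graph] by (simp add: Z_matrix_def)

lemma A_sym: "A\<^sup>T = A"
proof (rule eq_matI)
  fix i j assume "i < dim_row A" "j < dim_col A"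
  then have "i < n" "j < n" using F(1) by auto
  then have "A\<^sup>T $$ (i,j) = A $$ (j,i)"
    using carrier_matD[OF A_carrier] by (intro index_transpose_mat(1)) simp_all
  also have "\<dots> = A $$ (i,j)"
  proof (cases "i = j")
    case False
    then show ?thesis
      using \<open>i < n\<close> \<open>j < n\<close> A_offdiag(1)[of i j] A_offdiag(1)[of j i] laplacian_commute[of V E w]
      by metis
  qed simp
  finally show "A\<^sup>T $$ (i,j) = A $$ (i,j)" .
qed (use F(1) in auto)

lemma Y_loads_sources: "(\<Sum>v\<in>set (loads Ms). Y u v) = (\<Sum>v\<in>set (sources Ms). - Y u v)" if "u \<in> set (loads Ms)"
proof -
  have "(\<Sum>v\<in>V. Y u v) = (\<Sum>v\<in>set (loads Ms). Y u v) + (\<Sum>v\<in>set (sources Ms). Y u v)"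
    unfolding Ms(3) using Ms(2) by (intro sum.union_disjoint) auto
  then show ?thesis
    using laplacian_row_sum[of V u E w] that graph Ms(3) by (simp add: weighted_graph_def sum_negf)
qed

lemma load_source: "u \<in> set (loads Ms) \<Longrightarrow> v \<in> set (sources Ms) \<Longrightarrow> u \<noteq> v"
  using Ms(2) by auto

text \<open>Laplacian rows sum to 0, so the load columns contribute exactly the total weight of the
  edges to sources, and \<open>F\<close> can only add to it.\<close>

lemma row_sum_ge:
  assumes "i < n"
  shows "(\<Sum>v\<in>set (sources Ms). - Y (loads Ms ! i) v) \<le> (\<Sum>j<n. A $$ (i,j))"
proof -
  have "(\<Sum>j<n. A $$ (i,j)) = (\<Sum>j<n. Y (loads Ms ! i) (loads Ms ! j)) + (\<Sum>j<n. F $$ (i,j))"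
    using assms by (simp add: A_index sum.distrib del: index_add_mat)
  moreover have "0 \<le> (\<Sum>j<n. F $$ (i,j))"
    using assms F(3) unfolding nonneg_mat_iff[OF F(1)] by (intro sum_nonneg) auto
  ultimately show ?thesis
    using sum_nth_distinct[of "loads Ms" "Y (loads Ms ! i)"] Y_loads_sources[of "loads Ms ! i"] Ms(2) assms
    by simp
qed

lemma row_sum_nonneg: "i < n \<Longrightarrow> 0 \<le> (\<Sum>j<n. A $$ (i,j))"
  using laplacian_offdiag(1)[OF graph] load_source
  by (intro order.trans[OF sum_nonneg row_sum_ge]) (auto simp del: index_add_mat)

lemma b_index:
  assumes "i < n"
  shows "b $ i = (\<Sum>j<length (sources Ms). - Y (loads Ms ! i) (sources Ms ! j) * V_S $ j)"
proof -
  have "b $ i = - (node_mat Y (loads Ms) (sources Ms) *\<^sub>v V_S) $ i"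
    using assms by (simp add: node_mat_def)
  also have "\<dots> = - (\<Sum>j<length (sources Ms). node_mat Y (loads Ms) (sources Ms) $$ (i,j) * V_S $ j)"
    using V_S by (subst mult_mat_vec_index[OF node_mat_carrier _ assms]) (simp_all add: pos_vec_iff)
  finally show ?thesis using assms by (simp add: node_mat_index sum_negf)
qed

lemma b_summand:
  assumes "i < n" "j < length (sources Ms)"
  shows "0 \<le> - Y (loads Ms ! i) (sources Ms ! j) * V_S $ j"
    "{loads Ms ! i, sources Ms ! j} \<in> E \<Longrightarrow> 0 < - Y (loads Ms ! i) (sources Ms ! j) * V_S $ j"
proof -
  have *: "loads Ms ! i \<noteq> sources Ms ! j" using assms load_source by auto
  have "0 < V_S $ j" using assms V_S by (simp add: pos_vec_iff)
  then show "0 \<le> - Y (loads Ms ! i) (sources Ms ! j) * V_S $ j"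
    "{loads Ms ! i, sources Ms ! j} \<in> E \<Longrightarrow> 0 < - Y (loads Ms ! i) (sources Ms ! j) * V_S $ j"
    using laplacian_offdiag[OF graph *] by (auto simp: mult_nonpos_nonneg mult_neg_pos)
qed

lemma b_carrier: "b \<in> carrier_vec n"
  by (rule carrier_vecI) (simp add: node_mat_def)

lemma b_nonneg: "0\<^sub>v n \<le> b"
proof -
  have "0 \<le> b $ i" if "i < n" for i
    unfolding b_index[OF that] using b_summand(1)[OF that] by (intro sum_nonneg) simp
  then show ?thesis unfolding nonneg_vec_iff using b_carrier by blast
qed

text \<open>Start at a node of \<open>Q\<close> and follow its descending path. As long as it visits
  loads it stays in the first \<open>k\<close> microgrids, and closedness of \<open>Q\<close> keeps
  it in \<open>Q\<close>; the node just before the first source is the index sought, since an edge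
  to a source makes both the row sum and \<open>b\<close> positive there.\<close>

lemma grounded_leading: "grounded (block_start (load_block_sizes Ms) k) A b"
  unfolding grounded_def
proof (intro allI impI)
  let ?N = "block_start (load_block_sizes Ms) k"
  fix Q assume QN: "Q \<subseteq> {..<?N}" and ne: "Q \<noteq> {}"
    and closed: "\<forall>i\<in>Q. \<forall>j<?N. A $$ (i,j) \<noteq> 0 \<longrightarrow> j \<in> Q"
  have N: "?N \<le> n" using block_start_le[of "load_block_sizes Ms" k] by (simp add: sum_list_load_block_sizes)
  have lead_load: "v \<in> set (loads (take k Ms)) \<longleftrightarrow> (\<exists>i<?N. v = loads Ms ! i)" for v
    unfolding take_loads[symmetric] using N by (auto simp: in_set_conv_nth min_absorb2)
  obtain i0 where i0: "i0 \<in> Q" using ne by auto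
  then have "loads Ms ! i0 \<in> set (loads (take k Ms))" using QN lead_load by auto
  then obtain s where s: "s < k" "s < length Ms" "loads Ms ! i0 \<in> set (fst (Ms ! s))"
    by (auto simp: loads_def in_set_conv_nth[of _ "take k Ms"])
  have "loads Ms ! i0 \<in> set (loads Ms)" using i0 QN N by auto
  then obtain p where p: "p \<noteq> []" "hd p = loads Ms ! i0" "last p \<in> set (sources Ms)"
      "successively (\<lambda>x y. {x, y} \<in> E) p"
    and desc: "\<And>i j s t. i < j \<Longrightarrow> j < length p \<Longrightarrow> s < length Ms \<Longrightarrow> t < length Ms \<Longrightarrow>
      p ! i \<in> nodes (Ms ! s) \<Longrightarrow> p ! j \<in> nodes (Ms ! t) \<Longrightarrow> t \<le> s"
    using dpc unfolding descending_path_condition_def by meson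
  have adj: "{p ! q, p ! Suc q} \<in> E" if "Suc q < length p" for q
    using p(4) that by (auto simp: successively_conv_nth)
  have "\<exists>q. Suc q < length p \<and> p ! q \<in> (!) (loads Ms) ` Q \<and> p ! Suc q \<in> set (sources Ms)"
  proof (rule ccontr)
    assume neg: "\<not> ?thesis"
    have "p ! q \<in> (!) (loads Ms) ` Q" if "q < length p" for q
      using that
    proof (induction q)
      case 0
      then show ?case using p(1,2) i0 by (auto simp: hd_conv_nth)
    next
      case (Suc q)
      then obtain i where i: "i \<in> Q" "p ! q = loads Ms ! i" by auto
      have e: "{p ! q, p ! Suc q} \<in> E" by (rule adj[OF Suc.prems])
      then have "p ! Suc q \<in> V" "p ! q \<noteq> p ! Suc q"
        using graph unfolding weighted_graph_def by fastforce+
      then have "p ! Suc q \<in> set (loads Ms)"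
        using neg Suc Ms(3) by auto
      then obtain M where M: "M \<in> set Ms" "p ! Suc q \<in> set (fst M)" by (auto simp: loads_def)
      then obtain t where t: "t < length Ms" "M = Ms ! t" by (auto simp: in_set_conv_nth)
      \<comment> \<open>Comparing with the start of the path is enough: position 0 lies in microgrid
        \<open>s\<close>, and \<open>s < k\<close>.\<close>
      have "t \<le> s"
        using desc[of 0 "Suc q" s t] Suc.prems s t M p(1,2) by (auto simp: nodes_def hd_conv_nth)
      then have "M \<in> set (take k Ms)" using t s(1) by (auto simp: in_set_conv_nth)
      then have "p ! Suc q \<in> set (loads (take k Ms))" using M by (auto simp: loads_def)
      then obtain j where j: "j < ?N" "p ! Suc q = loads Ms ! j" using lead_load by auto
      have "i \<noteq> j" using \<open>p ! q \<noteq> p ! Suc q\<close> i j by auto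
      moreover have "i < n" "j < n" using i j QN N by auto
      ultimately have "A $$ (i,j) \<noteq> 0"
        using A_offdiag[of i j] laplacian_offdiag(2)[OF graph, of "loads Ms ! i" "loads Ms ! j"] e i j
        by simp
      then show ?case using closed i j by auto
    qed
    \<comment> \<open>Without a step from \<open>Q\<close> into a source the whole path, including
      its final source, would consist of loads.\<close>
    then have "last p \<in> (!) (loads Ms) ` Q" using p(1) by (simp add: last_conv_nth)
    then have "last p \<in> set (loads Ms)" using QN N by auto
    then show False using p(3) load_source by blast
  qed
  then obtain i v where i: "i \<in> Q" and v: "v \<in> set (sources Ms)" and e: "{loads Ms ! i, v} \<in> E"
    using adj by fastforce
  have iN: "i < ?N" "i < n" using i QN N by auto
  obtain j where j: "j < length (sources Ms)" "v = sources Ms ! j" using v by (auto simp: in_set_conv_nth)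
  have "0 < b $ i"
    unfolding b_index[OF iN(2)]
    using b_summand[OF iN(2)] e j by (intro sum_pos2[of _ j]) auto
  \<comment> \<open>The full row sum is at least the weight of the edge to \<open>v\<close>;
    restricting it to the leading columns drops nonpositive entries only.\<close>
  moreover have "0 < (\<Sum>j<?N. A $$ (i,j))"
  proof -
    have "0 < (\<Sum>v\<in>set (sources Ms). - Y (loads Ms ! i) v)"
      using laplacian_offdiag[OF graph] load_source iN v e
      by (intro sum_pos2[of _ v]) (auto simp: less_imp_le)
    also have "\<dots> \<le> (\<Sum>j<n. A $$ (i,j))" by (rule row_sum_ge[OF iN(2)])
    also have "\<dots> = (\<Sum>j<?N. A $$ (i,j)) + (\<Sum>j\<in>{?N..<n}. A $$ (i,j))"
    proof -
      have "{..<n} = {..<?N} \<union> {?N..<n}" using N by auto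
      then show ?thesis by (simp add: sum.union_disjoint ivl_disj_int)
    qed
    also have "(\<Sum>j\<in>{?N..<n}. A $$ (i,j)) \<le> 0"
      using A_Z_matrix iN by (intro sum_nonpos) (auto simp: Z_matrix_def)
    finally show ?thesis by simp
  qed
  ultimately show "\<exists>i\<in>Q. 0 < (\<Sum>j<?N. A $$ (i,j)) \<and> 0 < b $ i" using i by blast
qed

lemma A_monotone: "monotone_mat n A"
proof -
  have "block_start (load_block_sizes Ms) (length Ms) = n"
    using block_start_length[of "load_block_sizes Ms"]
    by (simp add: sum_list_load_block_sizes) (simp add: load_block_sizes_def)
  then show ?thesis
    using grounded_monotone_mat[OF A_Z_matrix row_sum_nonneg, of b] grounded_leading[of "length Ms"] by simp
qed

lemma A_bcd_factors:
  "bcd_factors n A b (bcd_C (load_block_sizes Ms) A) (bcd_D (load_block_sizes Ms) A)"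
proof -
  have "load_block_sizes Ms \<noteq> []" using Ms(1) by (simp add: load_block_sizes_def)
  from bcd_factors_bcd[OF _ A_sym this _ _ _ grounded_leading, unfolded sum_list_load_block_sizes]
  show ?thesis using A_Z_matrix row_sum_nonneg b_carrier b_nonneg by blast
qed

end

subsection \<open>Attaching a microgrid\<close>

lemma vec_split_append:
  "u \<in> carrier_vec (n + p) \<Longrightarrow> vec n (\<lambda>i. u $ i) @\<^sub>v vec p (\<lambda>i. u $ (n + i)) = u"
  by (rule eq_vecI) auto

context schur_step
begin

text \<open>Here \<open>b\<^sub>1\<close> is the source vector of the old grid and
  \<open>f\<^sub>1 >= b\<^sub>1\<close> its counterpart after the interconnection, while
  \<open>K = D^-1 C^-1\<close> is the same for both. The upper and lower parts of the inequality
  decouple by \<open>step_mult_vec\<close>.\<close>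

lemma step_condition:
  assumes fac: "bcd_factors n A b\<^sub>1 C D"
    and b: "b\<^sub>1 \<in> carrier_vec n" "f\<^sub>1 \<in> carrier_vec n" "b\<^sub>1 \<le> f\<^sub>1" "f\<^sub>2 \<in> carrier_vec p"
    and c: "0\<^sub>v n \<lless> c\<^sub>1" "0\<^sub>v p \<lless> c\<^sub>2"
  defines "K' \<equiv> minv (four_block_mat D (0\<^sub>m n p) (0\<^sub>m p n) S) *
      minv (four_block_mat C (0\<^sub>m n p) (B * minv A * C) (1\<^sub>m p))"
  defines "u \<equiv> K' *\<^sub>v (f\<^sub>1 @\<^sub>v f\<^sub>2)"
  assumes u_pos: "0\<^sub>v (n + p) \<lless> u"
    and cond1: "minv D * minv C * minv (diag (minv D * minv C *\<^sub>v b\<^sub>1)) *\<^sub>v c\<^sub>1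
      \<lless> (1/4) \<cdot>\<^sub>v (minv D * minv C *\<^sub>v b\<^sub>1)"
    and cond2: "- (minv S * B * minv A * minv (diag (vec n (\<lambda>i. u $ i))) *\<^sub>v c\<^sub>1)
      + minv S * minv (diag (vec p (\<lambda>i. u $ (n + i)))) *\<^sub>v c\<^sub>2 \<lless> (1/4) \<cdot>\<^sub>v vec p (\<lambda>i. u $ (n + i))"
  shows "K' * minv (diag u) *\<^sub>v (c\<^sub>1 @\<^sub>v c\<^sub>2) \<lless> (1/4) \<cdot>\<^sub>v u"
proof -
  let ?K = "minv D * minv C"
  define U1 where "U1 = vec n (\<lambda>i. u $ i)"
  define U2 where "U2 = vec p (\<lambda>i. u $ (n + i))"
  have u: "u \<in> carrier_vec (n + p)" using u_pos by (simp add: pos_vec_iff)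
  have U12: "U1 @\<^sub>v U2 = u" unfolding U1_def U2_def by (rule vec_split_append[OF u])
  have Upos: "0\<^sub>v n \<lless> U1" "0\<^sub>v p \<lless> U2"
    using u_pos by (auto simp: pos_vec_iff U1_def U2_def)
  have cc: "c\<^sub>1 \<in> carrier_vec n" "c\<^sub>2 \<in> carrier_vec p" using c by (auto simp: pos_vec_iff)
  define q1 where "q1 = vec n (\<lambda>i. c\<^sub>1 $ i / U1 $ i)"
  define q2 where "q2 = vec p (\<lambda>i. c\<^sub>2 $ i / U2 $ i)"
  have q: "q1 \<in> carrier_vec n" "q2 \<in> carrier_vec p" by (simp_all add: q1_def q2_def)
  have Mq: "minv (diag U1) *\<^sub>v c\<^sub>1 = q1" "minv (diag U2) *\<^sub>v c\<^sub>2 = q2"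
    using minv_diag_mult_vec[OF Upos(1) cc(1)] minv_diag_mult_vec[OF Upos(2) cc(2)]
    by (simp_all add: q1_def q2_def)
  note M = minv_diag_carrier[OF Upos(1)] minv_diag_carrier[OF Upos(2)]
  have cCD: "minv C \<in> carrier_mat n n" "minv D \<in> carrier_mat n n"
    using CD[OF fac] by simp_all
  have K: "?K \<in> carrier_mat n n" using cCD by simp
  note K_nn = bcd_factors_minv_nonneg(2)[OF fac]
  have K': "K' \<in> carrier_mat (n + p) (n + p)"
    unfolding K'_def using carrier_invertible_dim(2)[OF C'_inv(1)[OF fac]]
      carrier_invertible_dim(2)[OF D'_inv(1)[OF fac]] by (rule mult_carrier_mat[rotated])
  have K'_mult: "K' *\<^sub>v (v\<^sub>1 @\<^sub>v v\<^sub>2) = (?K *\<^sub>v v\<^sub>1) @\<^sub>v (minv S *\<^sub>v (v\<^sub>2 - B * minv A *\<^sub>v v\<^sub>1))"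
    if "v\<^sub>1 \<in> carrier_vec n" "v\<^sub>2 \<in> carrier_vec p" for v\<^sub>1 v\<^sub>2
    unfolding K'_def by (rule step_mult_vec[OF fac that])
  have Kf: "?K *\<^sub>v f\<^sub>1 = U1"
  proof -
    have "U1 \<in> carrier_vec n" by (simp add: U1_def)
    moreover have "U1 @\<^sub>v U2 = (?K *\<^sub>v f\<^sub>1) @\<^sub>v (minv S *\<^sub>v (f\<^sub>2 - B * minv A *\<^sub>v f\<^sub>1))"
      unfolding U12 u_def by (rule K'_mult[OF b(2,4)])
    ultimately show ?thesis using append_vec_eq[OF _ mult_mat_vec_carrier[OF K b(2)]] by metis
  qed
  have "minv (diag u) *\<^sub>v (c\<^sub>1 @\<^sub>v c\<^sub>2) = q1 @\<^sub>v q2"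
    using minv_diag_mult_vec[OF u_pos, of "c\<^sub>1 @\<^sub>v c\<^sub>2"] cc unfolding U12[symmetric]
    by (intro eq_vecI) (auto simp: q1_def q2_def U1_def U2_def)
  then have lhs: "K' * minv (diag u) *\<^sub>v (c\<^sub>1 @\<^sub>v c\<^sub>2) =
      (?K *\<^sub>v q1) @\<^sub>v (minv S *\<^sub>v (q2 - B * minv A *\<^sub>v q1))"
    using assoc_mult_mat_vec[OF K' minv_diag_carrier[OF u_pos], of "c\<^sub>1 @\<^sub>v c\<^sub>2"] cc K'_mult[OF q] by simp
  \<comment> \<open>With \<open>u0 = K b\<^sub>1 <= K f\<^sub>1 = U1\<close>, nonnegativity of
    \<open>K\<close> gives \<open>K [U1]^-1 c\<^sub>1 <= K [u0]^-1 c\<^sub>1 < u0 / 4 <= U1 /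
    4\<close>.\<close>
  have top: "(?K *\<^sub>v q1) $ i < U1 $ i / 4" if i: "i < n" for i
  proof -
    define u0 where "u0 = ?K *\<^sub>v b\<^sub>1"
    have u0: "u0 \<in> carrier_vec n" unfolding u0_def by (rule mult_mat_vec_carrier[OF K b(1)])
    have u0_pos: "0\<^sub>v n \<lless> u0" using fac by (simp add: bcd_factors_def u0_def)
    have "u0 \<le> U1" unfolding u0_def Kf[symmetric] by (rule mult_mat_vec_mono[OF K K_nn b(1-3)])
    then have le: "u0 $ j \<le> U1 $ j" if "j < n" for j using that u0 by (auto simp: less_eq_vec_def U1_def)
    define q0 where "q0 = vec n (\<lambda>i. c\<^sub>1 $ i / u0 $ i)"
    have q0: "q0 \<in> carrier_vec n" by (simp add: q0_def)
    have "c\<^sub>1 $ j / U1 $ j \<le> c\<^sub>1 $ j / u0 $ j" if j: "j < n" for j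
    proof -
      have "0 < u0 $ j" "0 < c\<^sub>1 $ j" using u0_pos c(1) j by (auto simp: pos_vec_iff)
      then show ?thesis using le[OF j] by (intro divide_left_mono) auto
    qed
    then have "q1 \<le> q0" by (simp add: less_eq_vec_def q1_def q0_def)
    then have "?K *\<^sub>v q1 \<le> ?K *\<^sub>v q0" by (rule mult_mat_vec_mono[OF K K_nn q(1) q0])
    then have "(?K *\<^sub>v q1) $ i \<le> (?K *\<^sub>v q0) $ i"
      using i carrier_matD[OF K] by (simp add: less_eq_vec_def del: index_mult_mat_vec)
    also have "?K *\<^sub>v q0 = ?K * minv (diag u0) *\<^sub>v c\<^sub>1"
      using assoc_mult_mat_vec[OF K minv_diag_carrier[OF u0_pos] cc(1)]
        minv_diag_mult_vec[OF u0_pos cc(1)] by (simp add: q0_def)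
    also have "\<dots> $ i < u0 $ i / 4"
      using cond1 i u0 unfolding u0_def[symmetric] vec_less_def by (simp del: index_mult_mat_vec)
    also have "\<dots> \<le> U1 $ i / 4" using le[OF i] by simp
    finally show ?thesis .
  qed
  \<comment> \<open>This is \<open>cond2\<close> with \<open>minv S\<close> factored out and the
    matrix products reassociated.\<close>
  have bottom: "(minv S *\<^sub>v (q2 - B * minv A *\<^sub>v q1)) $ i < U2 $ i / 4" if i: "i < p" for i
  proof -
    have BAq: "B * minv A *\<^sub>v q1 \<in> carrier_vec p" by (rule mult_mat_vec_carrier[OF BA(1) q(1)])
    have SBA: "minv S * B * minv A \<in> carrier_mat p n" "minv S * B \<in> carrier_mat p n"
      using S_inv(1) B A(2) by simp_all
    have "minv S * B * minv A * minv (diag U1) *\<^sub>v c\<^sub>1 = minv S * B * minv A *\<^sub>v q1"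
      using assoc_mult_mat_vec[OF SBA(1) M(1) cc(1)] Mq by simp
    also have "\<dots> = minv S *\<^sub>v (B * minv A *\<^sub>v q1)"
      using assoc_mult_mat_vec[OF S_inv(1) BA(1) q(1)] assoc_mult_mat[OF S_inv(1) B A(2)] by simp
    finally have 1: "minv S * B * minv A * minv (diag U1) *\<^sub>v c\<^sub>1 = minv S *\<^sub>v (B * minv A *\<^sub>v q1)" .
    have 2: "minv S * minv (diag U2) *\<^sub>v c\<^sub>2 = minv S *\<^sub>v q2"
      using assoc_mult_mat_vec[OF S_inv(1) M(2) cc(2)] Mq by simp
    have "- (minv S *\<^sub>v (B * minv A *\<^sub>v q1)) + minv S *\<^sub>v q2 = minv S *\<^sub>v (q2 - B * minv A *\<^sub>v q1)"
      using vec_uminus_add[OF mult_mat_vec_carrier[OF S_inv(1) BAq] mult_mat_vec_carrier[OF S_inv(1) q(2)]]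
        mult_minus_distrib_mat_vec[OF S_inv(1) q(2) BAq] by simp
    then show ?thesis
      using cond2 i unfolding U1_def[symmetric] U2_def[symmetric] 1 2
      by (simp add: vec_less_def U2_def del: index_mult_mat_vec)
  qed
  have dims: "dim_vec (?K *\<^sub>v q1) = n" "dim_vec (minv S *\<^sub>v (q2 - B * minv A *\<^sub>v q1)) = p"
    using carrier_matD[OF K] carrier_matD[OF S_inv(1)] by simp_all
  show ?thesis
    unfolding lhs vec_less_def
  proof (intro conjI allI impI)
    show "dim_vec ((?K *\<^sub>v q1) @\<^sub>v (minv S *\<^sub>v (q2 - B * minv A *\<^sub>v q1))) = dim_vec ((1/4) \<cdot>\<^sub>v u)"
      using dims carrier_vecD[OF u] by (simp only: index_append_vec index_smult_vec)
    fix i assume "i < dim_vec ((1/4) \<cdot>\<^sub>v u)"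
    then have i: "i < n + p" using u by simp
    show "((?K *\<^sub>v q1) @\<^sub>v (minv S *\<^sub>v (q2 - B * minv A *\<^sub>v q1))) $ i < ((1/4) \<cdot>\<^sub>v u) $ i"
    proof (cases "i < n")
      case True
      then show ?thesis using top[OF True] i u dims
        by (simp add: U1_def del: index_mult_mat_vec dim_mult_mat_vec)
    next
      case False
      then have "i - n < p" "n + (i - n) = i" using i by auto
      then show ?thesis using bottom[of "i - n"] False i u dims
        by (simp add: U2_def del: index_mult_mat_vec dim_mult_mat_vec)
    qed
  qed
qed

end

lemma node_mat_append:
  "node_mat Y (us @ us') (vs @ vs') =
    four_block_mat (node_mat Y us vs) (node_mat Y us vs') (node_mat Y us' vs) (node_mat Y us' vs')"
  by (rule eq_matI) (auto simp: node_mat_def nth_append)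

text \<open>Cross edges change the old Laplacian only on its diagonal, so the load-source block is
  untouched. Only the rows of the first graph are treated; exchanging the two graphs gives the other
  half.\<close>

lemma interconnection_blocks:
  assumes "weighted_graph (set L \<union> set S) E\<^sub>1 w" "weighted_graph (set L' \<union> set S') E\<^sub>2 w"
    and dist: "distinct (L @ S @ L' @ S')"
    and "\<forall>e\<in>G. \<exists>u\<in>set L \<union> set S. \<exists>v\<in>set L' \<union> set S'. e = {u, v}"
  defines "Y \<equiv> laplacian ((set L \<union> set S) \<union> (set L' \<union> set S')) (E\<^sub>1 \<union> E\<^sub>2 \<union> G) w"
    and "Y\<^sub>1 \<equiv> laplacian (set L \<union> set S) E\<^sub>1 w"
  shows "node_mat Y L L = node_mat Y\<^sub>1 L L +
      - diag (node_mat Y L L' *\<^sub>v ones (length L') + node_mat Y L S' *\<^sub>v ones (length S'))"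
    and "node_mat Y L S = node_mat Y\<^sub>1 L S"
proof -
  have disj: "(set L \<union> set S) \<inter> (set L' \<union> set S') = {}" using dist by auto
  note lap = laplacian_interconnection[OF assms(1,2) disj assms(4)]
  have row: "(node_mat Y us vs *\<^sub>v ones (length vs)) $ i = (\<Sum>x\<in>set vs. Y (us ! i) x)"
    if "i < length us" "distinct vs" for us vs i
  proof -
    have "ones (length vs) \<in> carrier_vec (length vs)" by (simp add: ones_def)
    from mult_mat_vec_index[OF node_mat_carrier this that(1)]
    show ?thesis
      using that sum_nth_distinct[OF that(2), of "Y (us ! i)"] by (simp add: node_mat_index ones_def)
  qed
  show "node_mat Y L S = node_mat Y\<^sub>1 L S"
  proof (rule eq_matI)
    fix i j assume "i < dim_row (node_mat Y\<^sub>1 L S)" "j < dim_col (node_mat Y\<^sub>1 L S)"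
    then have ij: "i < length L" "j < length S" by (simp_all add: node_mat_def)
    then have "L ! i \<in> set L" "S ! j \<in> set S" by auto
    moreover from this have "L ! i \<noteq> S ! j" using dist by auto
    ultimately show "node_mat Y L S $$ (i,j) = node_mat Y\<^sub>1 L S $$ (i,j)"
      using ij lap[of "L ! i" "S ! j"] by (simp add: node_mat_index Y_def Y\<^sub>1_def)
  qed (simp_all add: node_mat_def)
  let ?d = "node_mat Y L L' *\<^sub>v ones (length L') + node_mat Y L S' *\<^sub>v ones (length S')"
  have dim: "dim_vec ?d = length L" by (simp add: node_mat_def)
  show "node_mat Y L L = node_mat Y\<^sub>1 L L + - diag ?d"
  proof (rule eq_matI)
    fix i j assume "i < dim_row (node_mat Y\<^sub>1 L L + - diag ?d)" "j < dim_col (node_mat Y\<^sub>1 L L + - diag ?d)"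
    then have ij: "i < length L" "j < length L"
      unfolding diag_def dim by (simp_all add: mat_diag_def)
    have "?d $ i = (\<Sum>x\<in>set L'. Y (L ! i) x) + (\<Sum>x\<in>set S'. Y (L ! i) x)"
      using row[OF ij(1), of L'] row[OF ij(1), of S'] dist ij
      by (subst index_add_vec(1)) (simp_all add: node_mat_def del: index_mult_mat_vec)
    also have "\<dots> = (\<Sum>x\<in>set L' \<union> set S'. Y (L ! i) x)"
      using dist by (intro sum.union_disjoint[symmetric]) auto
    finally have d: "?d $ i = (\<Sum>x\<in>set L' \<union> set S'. Y (L ! i) x)" .
    have "(node_mat Y\<^sub>1 L L + - diag ?d) $$ (i,j) =
        node_mat Y\<^sub>1 L L $$ (i,j) - (if i = j then ?d $ i else 0)"
      using ij unfolding diag_def dim by (simp add: mat_diag_def)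
    moreover have "i = j \<longleftrightarrow> L ! i = L ! j" using ij dist by (simp add: nth_eq_iff_index_eq)
    ultimately show "node_mat Y L L $$ (i,j) = (node_mat Y\<^sub>1 L L + - diag ?d) $$ (i,j)"
      using ij lap[of "L ! i" "L ! j"] d by (simp add: node_mat_index Y_def Y\<^sub>1_def)
  qed (unfold diag_def dim, simp_all add: mat_diag_def node_mat_def)
qed

lemma four_block_mat_diag:
  assumes "A \<in> carrier_mat n n" "diagonal_mat A" "0\<^sub>m n n \<le> (A :: real mat)"
    and "B \<in> carrier_mat p p" "diagonal_mat B" "0\<^sub>m p p \<le> B"
  shows "diagonal_mat (four_block_mat A (0\<^sub>m n p) (0\<^sub>m p n) B)"
    "0\<^sub>m (n + p) (n + p) \<le> four_block_mat A (0\<^sub>m n p) (0\<^sub>m p n) B"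
proof -
  show "diagonal_mat (four_block_mat A (0\<^sub>m n p) (0\<^sub>m p n) B)"
    unfolding diagonal_mat_def
  proof (intro allI impI)
    fix i j assume "i < dim_row (four_block_mat A (0\<^sub>m n p) (0\<^sub>m p n) B)"
      "j < dim_col (four_block_mat A (0\<^sub>m n p) (0\<^sub>m p n) B)" "i \<noteq> j"
    then show "four_block_mat A (0\<^sub>m n p) (0\<^sub>m p n) B $$ (i,j) = 0"
      using assms(1,2,4,5) by (cases "i < n"; cases "j < n") (auto simp: diagonal_mat_def)
  qed
  show "0\<^sub>m (n + p) (n + p) \<le> four_block_mat A (0\<^sub>m n p) (0\<^sub>m p n) B"
    using assms by (intro four_block_mat_nonneg) auto
qed

theorem theorem15:
  fixes Ms :: "'v microgrid list" and L\<^sub>1 S\<^sub>1 L\<^sub>2 S\<^sub>2 :: "'v list"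
    and \<E>\<^sub>1 \<E>\<^sub>2 \<E>\<^sub>1\<^sub>2 :: "'v set set" and w :: "'v set \<Rightarrow> real"
    and Y\<^sub>1 Y\<^sub>2 Y :: "'v \<Rightarrow> 'v \<Rightarrow> real"
    and E_L1 E_L2 :: "real mat" and V_S1 V_S2 P_L1 P_L2 :: "real vec"
  \<comment> \<open>original power grid\<close>
  assumes "L\<^sub>1 = loads Ms" and "S\<^sub>1 = sources Ms"
    and "Ms \<noteq> []" and "\<forall>M \<in> set Ms. fst M \<noteq> []"
    and "distinct (L\<^sub>1 @ S\<^sub>1 @ L\<^sub>2 @ S\<^sub>2)"
    and "weighted_graph (set L\<^sub>1 \<union> set S\<^sub>1) \<E>\<^sub>1 w"
    and "descending_path_condition Ms \<E>\<^sub>1"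
    and "Y\<^sub>1 = laplacian (set L\<^sub>1 \<union> set S\<^sub>1) \<E>\<^sub>1 w"
    and "Y_L1L1 = node_mat Y\<^sub>1 L\<^sub>1 L\<^sub>1" and "Y_L1S1 = node_mat Y\<^sub>1 L\<^sub>1 S\<^sub>1"
    and "n1 = length L\<^sub>1"
    and "E_L1 \<in> carrier_mat n1 n1" and "diagonal_mat E_L1" and "0\<^sub>m n1 n1 \<le> E_L1"
    and "V_S1 \<in> carrier_vec (length S\<^sub>1)" and "0\<^sub>v (length S\<^sub>1) \<lless> V_S1"
    and "P_L1 \<in> carrier_vec n1" and "0\<^sub>v n1 \<lless> P_L1"
    and "C = bcd_C (load_block_sizes Ms) (Y_L1L1 + E_L1)"
    and "D = bcd_D (load_block_sizes Ms) (Y_L1L1 + E_L1)"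
    and "V_L1' = - (minv (Y_L1L1 + E_L1) * Y_L1S1 *\<^sub>v V_S1)"
    and "minv D * minv C * minv (diag (C\<^sup>T *\<^sub>v V_L1')) *\<^sub>v P_L1 \<lless> (1/4) \<cdot>\<^sub>v (C\<^sup>T *\<^sub>v V_L1')"
  \<comment> \<open>new microgrid\<close>
    and "L\<^sub>2 \<noteq> []"
    and "weighted_graph (set L\<^sub>2 \<union> set S\<^sub>2) \<E>\<^sub>2 w"
    and "Y\<^sub>2 = laplacian (set L\<^sub>2 \<union> set S\<^sub>2) \<E>\<^sub>2 w"
    and "Y_L2L2 = node_mat Y\<^sub>2 L\<^sub>2 L\<^sub>2" and "Y_L2S2 = node_mat Y\<^sub>2 L\<^sub>2 S\<^sub>2"
    and "n2 = length L\<^sub>2"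
    and "E_L2 \<in> carrier_mat n2 n2" and "diagonal_mat E_L2" and "0\<^sub>m n2 n2 \<le> E_L2"
    and "V_S2 \<in> carrier_vec (length S\<^sub>2)" and "0\<^sub>v (length S\<^sub>2) \<lless> V_S2"
    and "P_L2 \<in> carrier_vec n2" and "0\<^sub>v n2 \<lless> P_L2"
  \<comment> \<open>interconnection\<close>
    and "\<forall>e \<in> \<E>\<^sub>1\<^sub>2. \<exists>u \<in> set L\<^sub>1 \<union> set S\<^sub>1. \<exists>v \<in> set L\<^sub>2 \<union> set S\<^sub>2. e = {u, v}"
    and "\<forall>e \<in> \<E>\<^sub>1\<^sub>2. 0 < w e"
    and "Y = laplacian ((set L\<^sub>1 \<union> set S\<^sub>1) \<union> (set L\<^sub>2 \<union> set S\<^sub>2)) (\<E>\<^sub>1 \<union> \<E>\<^sub>2 \<union> \<E>\<^sub>1\<^sub>2) w"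
    and "Y_L1L2 = node_mat Y L\<^sub>1 L\<^sub>2" and "Y_L1S2 = node_mat Y L\<^sub>1 S\<^sub>2"
    and "Y_L2L1 = node_mat Y L\<^sub>2 L\<^sub>1" and "Y_L2S1 = node_mat Y L\<^sub>2 S\<^sub>1"
    and "Ehat_L1 = - diag (Y_L1L2 *\<^sub>v ones n2 + Y_L1S2 *\<^sub>v ones (length S\<^sub>2))"
    and "Ehat_L2 = - diag (Y_L2L1 *\<^sub>v ones n1 + Y_L2S1 *\<^sub>v ones (length S\<^sub>1))"
    and "Ehat_L1 \<le> E_L1" and "Ehat_L2 \<le> E_L2"
    and "descending_path_condition (Ms @ [(L\<^sub>2, S\<^sub>2)]) (\<E>\<^sub>1 \<union> \<E>\<^sub>2 \<union> \<E>\<^sub>1\<^sub>2)"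
  \<comment> \<open>block Cholesky decomposition of the interconnection\<close>
    and "A' = four_block_mat (Y_L1L1 + E_L1) Y_L1L2 Y_L2L1 (Y_L2L2 + E_L2)"
    and "C' = bcd_C (load_block_sizes (Ms @ [(L\<^sub>2, S\<^sub>2)])) A'"
    and "D' = bcd_D (load_block_sizes (Ms @ [(L\<^sub>2, S\<^sub>2)])) A'"
    and "R = Y_L2L2 + E_L2 - Y_L2L1 * minv (C * D * C\<^sup>T) * Y_L1L2"
    and "Y_LS = four_block_mat Y_L1S1 Y_L1S2 Y_L2S1 Y_L2S2"
    and "V_L' = - (minv (C' * D' * C'\<^sup>T) * Y_LS *\<^sub>v (V_S1 @\<^sub>v V_S2))"
    and "U1 = vec n1 (\<lambda>i. (C'\<^sup>T *\<^sub>v V_L') $ i)"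
    and "U2 = vec n2 (\<lambda>i. (C'\<^sup>T *\<^sub>v V_L') $ (n1 + i))"
    and "- (minv R * Y_L2L1 * minv (C * D * C\<^sup>T) * minv (diag U1) *\<^sub>v P_L1)
           + minv R * minv (diag U2) *\<^sub>v P_L2 \<lless> (1/4) \<cdot>\<^sub>v U2"
  shows "minv D' * minv C' * minv (diag (C'\<^sup>T *\<^sub>v V_L')) *\<^sub>v (P_L1 @\<^sub>v P_L2)
           \<lless> (1/4) \<cdot>\<^sub>v (C'\<^sup>T *\<^sub>v V_L')
         \<and> feasible
             (four_block_mat (Y_L1L1 + Ehat_L1) Y_L1L2 Y_L2L1 (Y_L2L2 + Ehat_L2))
             (- (Y_LS *\<^sub>v (V_S1 @\<^sub>v V_S2)))
             (P_L1 @\<^sub>v P_L2)"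
proof -
  let ?V\<^sub>1 = "set L\<^sub>1 \<union> set S\<^sub>1" and ?V\<^sub>2 = "set L\<^sub>2 \<union> set S\<^sub>2"
  let ?E = "\<E>\<^sub>1 \<union> \<E>\<^sub>2 \<union> \<E>\<^sub>1\<^sub>2" and ?Ms = "Ms @ [(L\<^sub>2, S\<^sub>2)]"
  let ?s1 = "length S\<^sub>1" and ?s2 = "length S\<^sub>2"
  define A where "A = Y_L1L1 + E_L1"
  define G where "G = Y_L2L2 + E_L2"
  \<comment> \<open>The interconnected Laplacian already contains the shunts \<open>Ehat\<close>.
    The surplus of the virtual shunts over them is nonnegative by hypothesis, and adding it to
    \<open>Ahat\<close> gives \<open>A'\<close>.\<close>
  define F1 where "F1 = E_L1 - Ehat_L1"
  define F2 where "F2 = E_L2 - Ehat_L2"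
  define F where "F = four_block_mat F1 (0\<^sub>m n1 n2) (0\<^sub>m n2 n1) F2"
  define b where "b = - (Y_LS *\<^sub>v (V_S1 @\<^sub>v V_S2))"
  define Ahat where "Ahat = four_block_mat (Y_L1L1 + Ehat_L1) Y_L1L2 Y_L2L1 (Y_L2L2 + Ehat_L2)"
  note L1 = assms(1) and S1 = assms(2) and dist = assms(5) and n1 = assms(11) and n2 = assms(28)
  have loads': "loads ?Ms = L\<^sub>1 @ L\<^sub>2" and sources': "sources ?Ms = S\<^sub>1 @ S\<^sub>2"
    by (simp_all add: loads_def sources_def L1 S1)
  have sizes': "load_block_sizes ?Ms = load_block_sizes Ms @ [n2]"
    by (simp add: load_block_sizes_def n2)
  have sizes: "sum_list (load_block_sizes Ms) = n1"
    by (simp add: sum_list_load_block_sizes L1 n1)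
  have wg: "weighted_graph (?V\<^sub>1 \<union> ?V\<^sub>2) ?E w"
    unfolding weighted_graph_def
  proof (intro conjI ballI)
    fix e assume e: "e \<in> ?E"
    have "e \<subseteq> ?V\<^sub>1 \<union> ?V\<^sub>2 \<and> card e = 2 \<and> 0 < w e"
    proof (cases "e \<in> \<E>\<^sub>1\<^sub>2")
      case True
      then obtain u v where uv: "u \<in> ?V\<^sub>1" "v \<in> ?V\<^sub>2" "e = {u, v}" using assms(36) by meson
      then have "u \<noteq> v" using dist by auto
      with uv show ?thesis using True assms(37) by auto
    next
      case False
      then show ?thesis using e assms(6,24) unfolding weighted_graph_def by blast
    qed
    then show "e \<subseteq> ?V\<^sub>1 \<union> ?V\<^sub>2" "card e = 2" "0 < w e" by auto
  qed simp
  have c: "Y_L1L1 \<in> carrier_mat n1 n1" "Y_L2L2 \<in> carrier_mat n2 n2" "Y_L1L2 \<in> carrier_mat n1 n2"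
    "Y_L2L1 \<in> carrier_mat n2 n1" "Y_L1S1 \<in> carrier_mat n1 ?s1" "Y_L1S2 \<in> carrier_mat n1 ?s2"
    "Y_L2S1 \<in> carrier_mat n2 ?s1" "Y_L2S2 \<in> carrier_mat n2 ?s2"
    using node_mat_carrier
    unfolding assms(9) assms(10) assms(26) assms(27) assms(39) assms(40) assms(41) assms(42) n1 n2
    by blast+
  have blocks1: "node_mat Y L\<^sub>1 L\<^sub>1 = Y_L1L1 + Ehat_L1" "node_mat Y L\<^sub>1 S\<^sub>1 = Y_L1S1"
    using interconnection_blocks[OF assms(6,24) dist assms(36)]
    unfolding assms(8) assms(9) assms(10) assms(38) assms(39) assms(40) assms(43) n2 by simp_all
  have dist': "distinct (L\<^sub>2 @ S\<^sub>2 @ L\<^sub>1 @ S\<^sub>1)" using dist by auto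
  \<comment> \<open>Edges are unordered, so the two graphs may exchange roles.\<close>
  have "\<forall>e \<in> \<E>\<^sub>1\<^sub>2. \<exists>u \<in> ?V\<^sub>2. \<exists>v \<in> ?V\<^sub>1. e = {u, v}"
    using assms(36) by (metis insert_commute)
  from interconnection_blocks[OF assms(24,6) dist' this]
  have blocks2: "node_mat Y L\<^sub>2 L\<^sub>2 = Y_L2L2 + Ehat_L2" "node_mat Y L\<^sub>2 S\<^sub>2 = Y_L2S2"
    unfolding assms(25) assms(26) assms(27) assms(38) assms(41) assms(42) assms(44) n1
    by (simp_all add: Un_commute Un_left_commute)
  have hat: "Ehat_L1 \<in> carrier_mat n1 n1" "diagonal_mat Ehat_L1"
    "Ehat_L2 \<in> carrier_mat n2 n2" "diagonal_mat Ehat_L2"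
    using c unfolding assms(43) assms(44) by (auto simp: diag_def mat_diag_def diagonal_mat_def)
  have F1: "F1 \<in> carrier_mat n1 n1" "diagonal_mat F1" "0\<^sub>m n1 n1 \<le> F1"
    using hat(1,2) assms(12,13,45)
    by (auto simp: F1_def diagonal_mat_def less_eq_mat_def minus_carrier_mat)
  have F2: "F2 \<in> carrier_mat n2 n2" "diagonal_mat F2" "0\<^sub>m n2 n2 \<le> F2"
    using hat(3,4) assms(29,30,46)
    by (auto simp: F2_def diagonal_mat_def less_eq_mat_def minus_carrier_mat)
  have F: "F \<in> carrier_mat (n1 + n2) (n1 + n2)" "diagonal_mat F" "0\<^sub>m (n1 + n2) (n1 + n2) \<le> F"
    using four_block_mat_diag[OF F1 F2] F1(1) F2(1) by (simp_all add: F_def)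
  have Ahat: "node_mat Y (L\<^sub>1 @ L\<^sub>2) (L\<^sub>1 @ L\<^sub>2) = Ahat"
    unfolding node_mat_append blocks1 blocks2 Ahat_def assms(39) assms(41) ..
  have A'_F: "Ahat + F = A'"
  proof -
    have "Y_L1L1 + Ehat_L1 + F1 = A" "Y_L2L2 + Ehat_L2 + F2 = G"
      using c(1,2) hat(1,3) assms(12,29) by (auto simp: F1_def F2_def A_def G_def)
    moreover have "Y_L1L2 + 0\<^sub>m n1 n2 = Y_L1L2" "Y_L2L1 + 0\<^sub>m n2 n1 = Y_L2L1" using c by simp_all
    ultimately show ?thesis
      unfolding Ahat_def F_def assms(48) A_def[symmetric] G_def[symmetric]
      using c hat F1 F2 by (subst add_four_block_mat[of _ n1 n1 _ n2 _ n2]) simp_all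
  qed
  have Y_LS: "node_mat Y (L\<^sub>1 @ L\<^sub>2) (S\<^sub>1 @ S\<^sub>2) = Y_LS"
    unfolding node_mat_append blocks1 blocks2 assms(40) assms(42) assms(52) ..
  have Y_LS_c: "Y_LS \<in> carrier_mat (n1 + n2) (?s1 + ?s2)"
    using node_mat_carrier[of Y "L\<^sub>1 @ L\<^sub>2" "S\<^sub>1 @ S\<^sub>2"] by (simp add: Y_LS n1 n2)

  have "distinct (L\<^sub>1 @ S\<^sub>1)" using dist by auto
  \<comment> \<open>\<open>G1\<close> provides the factors of the old grid, \<open>G2\<close> those
    of \<open>A'\<close>, and \<open>G3\<close>, with zero shunt, the monotonicity of
    \<open>Ahat\<close> on which the fixed point argument rests.\<close>
  then interpret G1: grid Ms ?V\<^sub>1 \<E>\<^sub>1 w E_L1 V_S1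
    by unfold_locales
      (use assms(3,6,7,12-14,16) n1 in \<open>simp_all add: L1[symmetric] S1[symmetric]\<close>)
  have VS: "0\<^sub>v (?s1 + ?s2) \<lless> V_S1 @\<^sub>v V_S2" by (rule append_vec_pos[OF assms(16,33)])
  interpret G2: grid ?Ms "?V\<^sub>1 \<union> ?V\<^sub>2" ?E w F "V_S1 @\<^sub>v V_S2"
    by unfold_locales
      (use wg assms(47) dist F VS n1 n2 in \<open>auto simp: loads' sources'\<close>)
  interpret G3: grid ?Ms "?V\<^sub>1 \<union> ?V\<^sub>2" ?E w "0\<^sub>m (n1 + n2) (n1 + n2)" "V_S1 @\<^sub>v V_S2"
    by unfold_locales
      (use wg assms(47) dist VS n1 n2 in \<open>auto simp: loads' sources' diagonal_mat_def\<close>)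

  define b0 where "b0 = - (Y_L1S1 *\<^sub>v V_S1)"
  have fac1: "bcd_factors n1 A b0 C D" and A_mono: "monotone_mat n1 A" and A_sym: "A\<^sup>T = A"
    using G1.A_bcd_factors G1.A_monotone G1.A_sym
    unfolding L1[symmetric] S1[symmetric] assms(8)[symmetric] assms(9)[symmetric] assms(10)[symmetric]
      n1[symmetric] A_def[symmetric] b0_def[symmetric] assms(19)[folded A_def, symmetric]
      assms(20)[folded A_def, symmetric] by blast+
  have n12: "length (L\<^sub>1 @ L\<^sub>2) = n1 + n2" by (simp add: n1 n2)
  have fac2: "bcd_factors (n1 + n2) A' b C' D'" and A'_mono: "monotone_mat (n1 + n2) A'"
    and b_nonneg: "0\<^sub>v (n1 + n2) \<le> b"
    using G2.A_bcd_factors G2.A_monotone G2.b_nonneg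
    unfolding loads' sources' assms(38)[symmetric] Ahat Y_LS A'_F n12 b_def[symmetric]
      assms(49)[symmetric] assms(50)[symmetric] by blast+
  have Ahat_mono: "monotone_mat (n1 + n2) Ahat"
    using G3.A_monotone unfolding loads' assms(38)[symmetric] Ahat n12 using Ahat[symmetric] n12
    by (simp add: node_mat_def)

  have Y_sym: "Y u v = Y v u" for u v unfolding assms(38) by (rule laplacian_commute)
  have B_T: "Y_L2L1\<^sup>T = Y_L1L2"
    unfolding assms(39) assms(41) by (rule eq_matI) (simp_all add: node_mat_def Y_sym)
  have A'_eq: "A' = four_block_mat A Y_L2L1\<^sup>T Y_L2L1 G"
    unfolding assms(48) B_T A_def G_def ..
  have cA: "A \<in> carrier_mat n1 n1" "G \<in> carrier_mat n2 n2"
    using c assms(12,29) by (simp_all add: A_def G_def)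
  have Y_nonpos: "Y u v \<le> 0" if "u \<noteq> v" for u v
    unfolding assms(38) by (rule laplacian_offdiag(1)[OF wg that])
  have disj: "set L\<^sub>1 \<inter> set L\<^sub>2 = {}" "set L\<^sub>1 \<inter> set S\<^sub>2 = {}" using dist by auto
  have off: "L\<^sub>2 ! i \<noteq> L\<^sub>1 ! j" if "i < n2" "j < n1" for i j
    using that disj(1) unfolding n1 n2 by (metis nth_mem disjoint_iff)
  have B_nonpos: "0\<^sub>m n2 n1 \<le> - Y_L2L1"
    using c(4) Y_nonpos[OF off] by (subst nonneg_mat_iff) (auto simp: assms(41) node_mat_index n1 n2)
  interpret schur_step n1 n2 A Y_L2L1 G
    by unfold_locales
      (use A_mono A_sym c(4) B_nonpos cA A'_mono in \<open>simp_all add: A'_eq\<close>)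

  have CDC: "C * D * C\<^sup>T = A" "C' * D' * C'\<^sup>T = A'" using fac1 fac2 by (simp_all add: bcd_factors_def)
  have R: "R = S" unfolding assms(51) CDC G_def[symmetric] B_T ..
  have ne: "load_block_sizes Ms \<noteq> []" using assms(3) by (simp add: load_block_sizes_def)
  have C': "C' = four_block_mat C (0\<^sub>m n1 n2) (Y_L2L1 * minv A * C) (1\<^sub>m n2)"
    and D': "D' = four_block_mat D (0\<^sub>m n1 n2) (0\<^sub>m n2 n1) S"
    using bcd_snoc[of A "load_block_sizes Ms" Y_L2L1 n2 G] cA c(4) ne
    unfolding assms(49) assms(50) assms(19) assms(20) sizes' sizes A'_eq A_def[symmetric] by simp_all

  have b_c: "b \<in> carrier_vec (n1 + n2)" using b_nonneg by (simp add: nonneg_vec_iff)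
  have b0_c: "b0 \<in> carrier_vec n1" using c(5) assms(15) by (simp add: b0_def)
  have solve: "- (M * N *\<^sub>v v) = M *\<^sub>v (- (N *\<^sub>v v))"
    if "M \<in> carrier_mat n n" "N \<in> carrier_mat n m" "v \<in> carrier_vec m"
    for M N :: "real mat" and v n m
  proof -
    have "M *\<^sub>v (- (N *\<^sub>v v)) = - (M *\<^sub>v (N *\<^sub>v v))"
      using that by (intro eq_vecI) auto
    then show ?thesis using assoc_mult_mat_vec[OF that] by simp
  qed
  \<comment> \<open>By \<open>V_L'\<close> below, \<open>u\<close> is \<open>C'^T V_L'\<close>; its
    strict positivity is part of the invariant delivered by \<open>G2\<close>.\<close>
  define u where "u = minv D' * minv C' *\<^sub>v b"
  have V_L1': "C\<^sup>T *\<^sub>v V_L1' = minv D * minv C *\<^sub>v b0"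
    using bcd_factors_solution[OF fac1 b0_c] solve[OF _ c(5) assms(15), of "minv A"]
    unfolding assms(21) A_def[symmetric] b0_def by simp
  have V_L': "C'\<^sup>T *\<^sub>v V_L' = u"
    using bcd_factors_solution[OF fac2 b_c] solve[OF _ Y_LS_c, of "minv A'" "V_S1 @\<^sub>v V_S2"] VS
    unfolding assms(53) CDC u_def b_def by (simp add: pos_vec_iff)
  have u_pos: "0\<^sub>v (n1 + n2) \<lless> u" using fac2 by (simp add: bcd_factors_def u_def)

  define f1 where "f1 = - (Y_L1S1 *\<^sub>v V_S1 + Y_L1S2 *\<^sub>v V_S2)"
  define f2 where "f2 = - (Y_L2S1 *\<^sub>v V_S1 + Y_L2S2 *\<^sub>v V_S2)"
  have f: "f1 \<in> carrier_vec n1" "f2 \<in> carrier_vec n2"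
    using c assms(15,32) by (simp_all add: f1_def f2_def)
  have b_split: "b = f1 @\<^sub>v f2"
    unfolding b_def assms(52) f1_def f2_def
    using four_block_mat_mult_vec[OF c(5,6,7,8) assms(15,32)] c assms(15,32)
    by (auto intro!: eq_vecI)
  \<comment> \<open>The two vectors differ by \<open>- Y_L1S2 V_S2\<close>, the nonnegative
    contribution of new edges from old loads to new sources.\<close>
  have "b0 \<le> f1"
    unfolding less_eq_vec_def
  proof (intro conjI allI impI)
    show "dim_vec b0 = dim_vec f1" using f b0_c by simp
    fix i assume "i < dim_vec f1"
    then have i: "i < n1" using f by simp
    have "L\<^sub>1 ! i \<noteq> S\<^sub>2 ! j" if "j < ?s2" for j
      using that i disj(2) unfolding n1 by (metis nth_mem disjoint_iff)
    then have "(Y_L1S2 *\<^sub>v V_S2) $ i \<le> 0"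
      unfolding mult_mat_vec_index[OF c(6) assms(32) i]
      using Y_nonpos i assms(33)
      by (intro sum_nonpos mult_nonpos_nonneg)
        (auto simp: assms(40) node_mat_index n1 pos_vec_iff less_imp_le)
    moreover have "f1 $ i = b0 $ i - (Y_L1S2 *\<^sub>v V_S2) $ i"
      using i c(5,6) by (simp add: f1_def b0_def del: index_mult_mat_vec)
    ultimately show "b0 $ i \<le> f1 $ i" by simp
  qed
  \<comment> \<open>The invariant for \<open>C\<close> and \<open>D\<close> is taken with the old
    source vector \<open>b0\<close>, to which the hypothesis of the old grid refers, whereas
    \<open>u\<close> is formed with the full vector \<open>f1 @\<^sub>v f2\<close>.\<close>
  have part1: "minv D' * minv C' * minv (diag u) *\<^sub>v (P_L1 @\<^sub>v P_L2) \<lless> (1/4) \<cdot>\<^sub>v u"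
    unfolding u_def b_split C' D'
  proof (rule step_condition[OF fac1 b0_c f(1) \<open>b0 \<le> f1\<close> f(2) assms(18,35)])
    show "0\<^sub>v (n1 + n2) \<lless> minv (four_block_mat D (0\<^sub>m n1 n2) (0\<^sub>m n2 n1) S) *
      minv (four_block_mat C (0\<^sub>m n1 n2) (Y_L2L1 * minv A * C) (1\<^sub>m n2)) *\<^sub>v (f1 @\<^sub>v f2)"
      using u_pos unfolding u_def b_split C' D' .
    show "minv D * minv C * minv (diag (minv D * minv C *\<^sub>v b0)) *\<^sub>v P_L1
      \<lless> (1/4) \<cdot>\<^sub>v (minv D * minv C *\<^sub>v b0)"
      using assms(22) unfolding V_L1' .
  qed (use assms(56) in \<open>unfold R CDC assms(54) assms(55) V_L', unfold u_def b_split C' D'\<close>)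
  have P: "0\<^sub>v (n1 + n2) \<lless> P_L1 @\<^sub>v P_L2" by (rule append_vec_pos[OF assms(18,35)])
  obtain y where y: "0\<^sub>v (n1 + n2) \<lless> y"
    and sub: "\<And>i. i < n1 + n2 \<Longrightarrow> (A' *\<^sub>v y) $ i + (P_L1 @\<^sub>v P_L2) $ i / y $ i \<le> b $ i"
    using bcd_factors_subsolution[OF fac2 b_c P] part1 unfolding u_def by blast
  have cAhat: "Ahat \<in> carrier_mat (n1 + n2) (n1 + n2)" using Ahat_mono by (simp add: monotone_mat_def)
  have y_c: "y \<in> carrier_vec (n1 + n2)" using y by (simp add: pos_vec_iff)
  have "0\<^sub>v (n1 + n2) \<le> y" using y by (auto simp: nonneg_vec_iff pos_vec_iff less_imp_le)
  then have Fy: "0\<^sub>v (n1 + n2) \<le> F *\<^sub>v y" by (rule mult_mat_vec_nonneg[OF F(1,3)])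
  \<comment> \<open>\<open>A' y\<close> exceeds \<open>Ahat y\<close> by \<open>F y >= 0\<close>, so
    the subsolution for the virtual shunts is one for the actual interconnection.\<close>
  have "(Ahat *\<^sub>v y) $ i \<le> (A' *\<^sub>v y) $ i" if "i < n1 + n2" for i
    unfolding A'_F[symmetric] add_mult_distrib_mat_vec[OF cAhat F(1) y_c]
    using Fy that F(1) by (simp add: nonneg_vec_iff del: index_mult_mat_vec)
  with sub have "feasible Ahat b (P_L1 @\<^sub>v P_L2)"
    by (intro feasibleI[OF Ahat_mono b_nonneg P y]) (meson add_right_mono order.trans)
  with part1 show ?thesis unfolding V_L' Ahat_def b_def by blast
qed

end
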